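(* Let $n\ge 2$, let $\Omega\subset\mathbb{R}^n$ be a bounded domain, let $h\colon\mathbb{R}\to\mathbb{R}$ be continuous, and let $u\in C^1(\Omega;\mathbb{R}^n)$ be a weak solution of the equation $$\operatorname{div}\big(h(\det Du)\operatorname{cof} Du\big)=0\quad\text{in }\Omega .$$ Then $h(\det Du)$ is constant on $\Omega$.
   Context: $\mathbb{M}^{n\times n}$ is the space of real $n\times n$ matrices with inner product $A:B=\sum_{i,j}A^i_jB^i_j$; $\operatorname{cof}A$ is the cofactor matrix, so that $A^T\operatorname{cof}A=(\operatorname{cof}A)A^T=(\det A)I$. $Du$ is the Jacobian matrix, $(Du)^i_j=\partial u^i/\partial x_j$. A function $u\in W^{1,1}_{loc}(\Omega;\mathbb{R}^n)$ is a weak solution of $\operatorname{div}(h(\det Du)\operatorname{cof}Du)=0$ in $\Omega$ if $h(\det Du)\operatorname{cof}Du\in L^1_{loc}(\Omega;\mathbb{M}^{n\times n})$ and $\int_\Omega h(\det Du)\operatorname{cof}Du:D\zeta\,dx=0$ for all $\zeta\in C^1_c(\Omega;\mathbb{R}^n)$. *)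

theory Defs
  imports "HOL-Analysis.Analysis"
begin

text \<open>The inner product \<open>A : B\<close> of matrices is the library's \<open>inner\<close> on \<^typ>\<open>real^'n^'n\<close>.
  The Jacobian matrix is the library's \<^const>\<open>jacobian\<close>, whose entry \<open>$ i $ j\<close> is the \<open>j\<close>-th
  partial derivative of the \<open>i\<close>-th component.\<close>

text \<open>Since \<^typ>\<open>'n\<close> is not ordered, the signed minor is written as the determinant of \<open>A\<close>
  with row \<open>i\<close> and column \<open>j\<close> cleared and the entry at \<open>(i, j)\<close> set to 1.\<close>

definition cof :: "real^'n^'n \<Rightarrow> real^'n^'n" where
  "cof A = (\<chi> i j. det (\<chi> k l. if k = i \<and> l = j then 1
                             else if k = i \<or> l = j then 0 else A $ k $ l))"

lemma cof_transpose: "cof (transpose A) = transpose (cof A)"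
proof -
  have "cof (transpose A) $ i $ j = cof A $ j $ i" for i j
  proof -
    have "(\<chi> k l. if k = i \<and> l = j then 1 else if k = i \<or> l = j then 0 else transpose A $ k $ l)
        = transpose (\<chi> k l. if k = j \<and> l = i then 1 else if k = j \<or> l = i then 0 else A $ k $ l)"
      by (auto simp: vec_eq_iff transpose_def)
    then show ?thesis by (simp add: cof_def)
  qed
  then show ?thesis by (simp add: vec_eq_iff transpose_def)
qed

lemma cof_row:
  fixes A :: "real^'n^'n"
  shows "cof A $ i $ j = det (\<chi> k. if k = i then axis j 1 else A $ k)"
proof -
  let ?M = "\<lambda>S. (\<chi> k. if k = i then axis j 1
                     else if k \<in> S then A $ k - (A $ k $ j) *s axis j 1 else A $ k) :: real^'n^'n"
  have "det (?M S) = det (?M {})" if "finite S" for S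
    using that
  proof (induction S)
    case (insert m S)
    show ?case
    proof (cases "m = i")
      case True
      then have "?M (insert m S) = ?M S" by (auto simp: vec_eq_iff)
      with insert.IH show ?thesis by simp
    next
      case False
      have "?M (insert m S) = (\<chi> k. if k = m then row m (?M S) + (- (A $ m $ j)) *s row i (?M S)
                                       else row k (?M S))"
        using False insert.hyps by (auto simp: vec_eq_iff row_def)
      with det_row_operation[OF False, of "?M S" "- (A $ m $ j)"] insert.IH
      show ?thesis by simp
    qed
  qed simp
  from this[of UNIV] have "det (?M UNIV) = det (?M {})" by simp
  moreover have "?M UNIV = (\<chi> k l. if k = i \<and> l = j then 1
                                   else if k = i \<or> l = j then 0 else A $ k $ l)"
    by (auto simp: vec_eq_iff axis_def)
  ultimately show ?thesis by (simp add: cof_def cong: if_cong)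
qed

lemma cof_mult_transpose:
  fixes A :: "real^'n^'n"
  shows "cof A ** transpose A = det A *\<^sub>R mat 1"
proof -
  have "(cof A ** transpose A) $ i $ m = (det A *\<^sub>R mat 1) $ i $ m" for i m
  proof -
    have row: "A $ m = (\<Sum>j\<in>UNIV. (A $ m $ j) *s axis j 1)"
      by (simp add: vec_eq_iff axis_def if_distrib cong: if_cong)
    have "(cof A ** transpose A) $ i $ m
        = (\<Sum>j\<in>UNIV. A $ m $ j * det (\<chi> k. if k = i then axis j 1 else A $ k))"
      by (simp add: matrix_matrix_mult_def transpose_def cof_row mult.commute)
    also have "\<dots> = (\<Sum>j\<in>UNIV. det (\<chi> k. if k = i then (A $ m $ j) *s axis j 1 else A $ k))"
      by (simp add: det_row_mul)
    also have "\<dots> = det (\<chi> k. if k = i then (\<Sum>j\<in>UNIV. (A $ m $ j) *s axis j 1) else A $ k)"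
      by (rule det_linear_row_sum[symmetric]) simp
    also have "\<dots> = det (\<chi> k. if k = i then A $ m else A $ k)"
      by (simp only: row[symmetric])
    also have "\<dots> = (if i = m then det A else 0)"
    proof (cases "i = m")
      case True
      then have "(\<chi> k. if k = i then A $ m else A $ k) = A" by (auto simp: vec_eq_iff)
      with True show ?thesis by simp
    next
      case False
      then have "det (\<chi> k. if k = i then A $ m else A $ k) = 0"
        by (intro det_identical_rows[OF False]) (auto simp: row_def vec_eq_iff)
      with False show ?thesis by simp
    qed
    finally show ?thesis by (simp add: mat_def)
  qed
  then show ?thesis by (simp add: vec_eq_iff)
qed

lemma transpose_mult_cof: "transpose A ** cof A = det A *\<^sub>R mat 1"
proof -
  have "transpose (transpose A ** cof A) = cof (transpose A) ** transpose (transpose A)"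
    by (simp add: matrix_transpose_mul cof_transpose)
  also have "\<dots> = det A *\<^sub>R mat 1"
    by (subst cof_mult_transpose) simp
  finally have "transpose A ** cof A = transpose (det A *\<^sub>R mat 1)"
    by (metis transpose_transpose)
  then show ?thesis by (simp add: vec_eq_iff transpose_def mat_def)
qed

definition C1_on :: "(real^'n \<Rightarrow> 'b::real_normed_vector) \<Rightarrow> (real^'n) set \<Rightarrow> bool" where
  "C1_on f \<Omega> \<longleftrightarrow>
     (\<forall>x\<in>\<Omega>. f differentiable (at x)) \<and>
     (\<forall>j. continuous_on \<Omega> (\<lambda>x. frechet_derivative f (at x) (axis j 1)))"

text \<open>Only the values on \<open>\<Omega>\<close> matter; a function on \<open>\<Omega>\<close> is represented by a total function.\<close>

definition C1c_on :: "(real^'n \<Rightarrow> 'b::real_normed_vector) \<Rightarrow> (real^'n) set \<Rightarrow> bool" where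
  "C1c_on f \<Omega> \<longleftrightarrow>
     C1_on f \<Omega> \<and>
     compact (closure {x\<in>\<Omega>. f x \<noteq> 0}) \<and> closure {x\<in>\<Omega>. f x \<noteq> 0} \<subseteq> \<Omega>"

definition L1loc_on :: "(real^'n \<Rightarrow> 'b::euclidean_space) \<Rightarrow> (real^'n) set \<Rightarrow> bool" where
  "L1loc_on f \<Omega> \<longleftrightarrow> (\<forall>K. compact K \<and> K \<subseteq> \<Omega> \<longrightarrow> f absolutely_integrable_on K)"

definition weak_jacobian_on ::
    "(real^'n \<Rightarrow> real^'n) \<Rightarrow> (real^'n \<Rightarrow> real^'n^'n) \<Rightarrow> (real^'n) set \<Rightarrow> bool" where
  "weak_jacobian_on u G \<Omega> \<longleftrightarrow>
     (\<forall>\<phi> :: real^'n \<Rightarrow> real. C1c_on \<phi> \<Omega> \<longrightarrow>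
        (\<forall>i j. (LINT x:\<Omega>|lebesgue. u x $ i * frechet_derivative \<phi> (at x) (axis j 1)) =
               - (LINT x:\<Omega>|lebesgue. G x $ i $ j * \<phi> x)))"

text \<open>The first three conjuncts say that \<open>u\<close> belongs to \<open>W\<^sup>1\<^sup>,\<^sup>1\<^sub>l\<^sub>o\<^sub>c\<close> with
  weak Jacobian \<open>G\<close>. As \<open>G\<close> is unique up to a null set, the existential quantifier
  does not depend on the choice of \<open>G\<close>.\<close>

definition weak_solution ::
    "(real \<Rightarrow> real) \<Rightarrow> (real^'n \<Rightarrow> real^'n) \<Rightarrow> (real^'n) set \<Rightarrow> bool" where
  "weak_solution h u \<Omega> \<longleftrightarrow>
     (\<exists>G. L1loc_on u \<Omega> \<and> L1loc_on G \<Omega> \<and> weak_jacobian_on u G \<Omega> \<and>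
        L1loc_on (\<lambda>x. h (det (G x)) *\<^sub>R cof (G x)) \<Omega> \<and>
        (\<forall>\<zeta> :: real^'n \<Rightarrow> real^'n. C1c_on \<zeta> \<Omega> \<longrightarrow>
           (LINT x:\<Omega>|lebesgue.
              inner (h (det (G x)) *\<^sub>R cof (G x)) (jacobian \<zeta> (at x))) = 0))"

end

theory Submission
  imports Defs "HOL-Real_Asymp.Real_Asymp"
begin

text \<open>Write \<open>J = det Du\<close> and \<open>g = h J\<close>. The proof rests on testing the equation with functions of \<open>u\<close>:
  for \<open>\<zeta> x = \<psi> (u x) v\<close> with a scalar function \<open>\<psi>\<close> and a fixed vector \<open>v\<close>, the identity between a matrix and its cofactor matrix turns
  \<open>cof Du : D\<zeta>\<close> into \<open>J\<close> times the derivative of \<open>\<psi>\<close> in direction \<open>v\<close>, evaluated at \<open>u\<close>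
  (\<open>inner_cof_rank_one\<close>). The equation then says that the integral of \<open>g J (D\<psi> v)(u)\<close> vanishes. Near a point with
  \<open>J \<noteq> 0\<close> the map \<open>u\<close> is a chart, and in that chart the statement reads: the distributional gradient of \<open>g\<close> is zero.

  This is made quantitative with bumps \<open>\<psi>\<close> centred at a moving point \<open>y\<close>. Differentiating under the integral sign, the
  integral of \<open>g \<bar>J\<bar> \<psi>(u)\<close> does not change with \<open>y\<close> (\<open>integral_bump_compose_constant\<close>), and by the change of variables formula
  neither does the total weight, the integral of \<open>\<bar>J\<bar> \<psi>(u)\<close> (\<open>has_integral_bump_compose\<close>). So the averages of \<open>g\<close> near any two nearby
  points agree, and letting the bumps shrink, \<open>g\<close> is constant near every point with \<open>J \<noteq> 0\<close>
  (\<open>locally_constant_at_nonzero_det\<close>).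

  Where \<open>J = 0\<close> the function \<open>g\<close> takes the single value \<open>h 0\<close>. A level set of \<open>g\<close> at a different value is therefore closed and open in
  \<open>\<Omega>\<close>, so by connectedness either \<open>g\<close> equals \<open>h 0\<close> throughout or it is constant with another value.

  The equation is formulated with a weak Jacobian \<open>G\<close>. It may be replaced by the classical one because the two agree almost
  everywhere on balls (\<open>weak_jacobian_eq_jacobian\<close>): integration by parts makes their difference orthogonal to all
  test functions, and an integrable function with this property vanishes almost everywhere (\<open>negligible_if_orthogonal_to_C1\<close>).\<close>

section \<open>Change of variables for arbitrary finite index types\<close>

text \<open>The change of variables formula enumerates the coordinates of a vector, so it lives on well-ordered
  index types. An arbitrary finite index type carries no order; this copy of it does, and any bijection
  between the two transports the formula.\<close>

typedef ('n::finite) ranked = "{..<CARD('n)} :: nat set"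
  using zero_less_card_finite by blast

instantiation ranked :: (finite) "{finite, wellorder}"
begin

definition less_eq_ranked :: "'a ranked \<Rightarrow> 'a ranked \<Rightarrow> bool" where
  "less_eq_ranked k l \<longleftrightarrow> Rep_ranked k \<le> Rep_ranked l"

definition less_ranked :: "'a ranked \<Rightarrow> 'a ranked \<Rightarrow> bool" where
  "less_ranked k l \<longleftrightarrow> Rep_ranked k < Rep_ranked l"

instance
proof
  have "(UNIV :: 'a ranked set) = Abs_ranked ` {..<CARD('a)}"
    by (rule type_definition.univ [OF type_definition_ranked])
  then show "finite (UNIV :: 'a ranked set)" by (metis finite_imageI finite_lessThan)
next
  fix P :: "'a ranked \<Rightarrow> bool" and a :: "'a ranked"
  assume step: "\<And>x. (\<And>y. y < x \<Longrightarrow> P y) \<Longrightarrow> P x"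
  show "P a"
    by (induction "Rep_ranked a" arbitrary: a rule: less_induct)
       (auto simp: less_ranked_def intro: step)
qed (auto simp: less_eq_ranked_def less_ranked_def Rep_ranked_inject)

end

lemma ex_bij_ranked: "\<exists>f :: 'n::finite ranked \<Rightarrow> 'n. bij f"
proof -
  have "card (UNIV :: 'n ranked set) = CARD('n)"
    using type_definition.card [OF type_definition_ranked[where 'n='n]] by simp
  then show ?thesis
    by (intro finite_same_card_bij) auto
qed

definition reindex :: "('m \<Rightarrow> 'n) \<Rightarrow> real^'n \<Rightarrow> real^'m" where
  "reindex f x = (\<chi> k. x $ f k)"

lemma reindex_nth [simp]: "reindex f x $ k = x $ f k"
  by (simp add: reindex_def)

lemma bounded_linear_reindex: "bounded_linear (reindex f :: real^'n::finite \<Rightarrow> real^'m::finite)"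
  by (rule linear_conv_bounded_linear[THEN iffD1]) (auto intro!: linearI simp: vec_eq_iff)

lemma reindex_inv:
  assumes "bij f"
  shows "reindex f (reindex (inv f) x) = x" "reindex (inv f) (reindex f y) = y"
  using assms by (auto simp: vec_eq_iff bij_is_inj bij_is_surj surj_f_inv_f)

lemma reindex_cbox:
  fixes f :: "'m::finite \<Rightarrow> 'n::finite"
  assumes "bij f"
  shows "reindex f ` cbox a b = cbox (reindex f a) (reindex f b)"
proof
  show "reindex f ` cbox a b \<subseteq> cbox (reindex f a) (reindex f b)"
    by (auto simp: mem_box_cart)
  show "cbox (reindex f a) (reindex f b) \<subseteq> reindex f ` cbox a b"
  proof
    fix y assume "y \<in> cbox (reindex f a) (reindex f b)"
    then have y: "a $ f k \<le> y $ k" "y $ k \<le> b $ f k" for k by (auto simp: mem_box_cart)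
    have "a $ i \<le> y $ inv f i \<and> y $ inv f i \<le> b $ i" for i
      using y[of "inv f i"] assms by (simp add: bij_is_surj surj_f_inv_f)
    then have "reindex (inv f) y \<in> cbox a b"
      by (auto simp: mem_box_cart)
    then show "y \<in> reindex f ` cbox a b"
      using reindex_inv(1)[OF assms, of y] by (metis imageI)
  qed
qed

lemma content_reindex_cbox:
  fixes f :: "'m::finite \<Rightarrow> 'n::finite"
  assumes "bij f"
  shows "measure lborel (reindex f ` cbox a b) = measure lborel (cbox a b)"
proof (cases "cbox a b = {}")
  case False
  then have "cbox (reindex f a) (reindex f b) \<noteq> {}"
    unfolding reindex_cbox[OF assms, symmetric] by simp
  then show ?thesis
    using False assms
    by (simp add: reindex_cbox content_cbox_cart
        prod.reindex_bij_betw[where h=f and g="\<lambda>i. b $ i - a $ i"])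
qed simp

text \<open>Relabelling coordinates maps boxes to boxes of the same volume, so it leaves integrals unchanged.\<close>

lemma has_integral_reindex:
  fixes f :: "'m::finite \<Rightarrow> 'n::finite" and F :: "real^'m \<Rightarrow> 'c::real_normed_vector"
  assumes "bij f" and "(F has_integral i) (cbox (reindex f a) (reindex f b))"
  shows "((\<lambda>x. F (reindex f x)) has_integral i) (cbox a b)"
proof -
  have bij: "bij (inv f)" using assms(1) by (rule bij_imp_bij_inv)
  have "((\<lambda>x. F (reindex f x)) has_integral (1 / 1) *\<^sub>R i)
          (reindex (inv f) ` cbox (reindex f a) (reindex f b))"
    by (rule has_integral_twiddle[OF _ _ _ _ _ _ _ assms(2)])
       (auto simp: reindex_inv[OF assms(1)] reindex_cbox[OF assms(1)] reindex_cbox[OF bij]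
          content_reindex_cbox[OF assms(1), unfolded reindex_cbox[OF assms(1)]]
         intro!: linear_continuous_at[OF bounded_linear_reindex])
  then show ?thesis
    by (simp add: reindex_cbox[OF bij] reindex_inv[OF assms(1)])
qed

text \<open>Conjugation by the bijection carries permutations of one index type to permutations of the other
  and preserves their signs, so the two Leibniz expansions agree term by term.\<close>

lemma det_reindex:
  fixes f :: "'m::finite \<Rightarrow> 'n::finite" and A :: "real^'n^'n"
  assumes "bij f"
  shows "det (\<chi> k l. A $ f k $ f l) = det A"
proof -
  let ?\<Phi> = "map_permutation UNIV f"
  have inj: "inj f" and surj: "surj f" using assms by (auto simp: bij_def)
  have app: "?\<Phi> p (f k) = f (p k)" for p k
    using inj surj by (simp add: map_permutation_def restrict_id_def)
  have bij: "bij_betw ?\<Phi> {p. p permutes UNIV} {p. p permutes UNIV}"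
  proof (rule bij_betw_byWitness[where f' = "map_permutation UNIV (inv f)"])
    have i: "bij (inv f)" using assms by (rule bij_imp_bij_inv)
    then have inj': "inj (inv f)" by (simp add: bij_def)
    show "\<forall>p\<in>{p. p permutes UNIV}. map_permutation UNIV (inv f) (?\<Phi> p) = p"
      using inj inj' map_permutation_compose[OF assms inj'] map_permutation_id[where A=UNIV] by auto
    show "\<forall>p\<in>{p. p permutes UNIV}. ?\<Phi> (map_permutation UNIV (inv f) p) = p"
      using surj map_permutation_compose[OF i inj] map_permutation_id[where A=UNIV] by (auto simp: surj_iff)
    show "?\<Phi> ` {p. p permutes UNIV} \<subseteq> {p. p permutes UNIV}"
      using map_permutation_permutes[OF assms] by blast
    show "map_permutation UNIV (inv f) ` {p. p permutes UNIV} \<subseteq> {p. p permutes UNIV}"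
      using map_permutation_permutes[OF i] by blast
  qed
  have "det A = (\<Sum>p | p permutes UNIV. of_int (sign (?\<Phi> p)) * (\<Prod>i\<in>UNIV. A $ i $ ?\<Phi> p i))"
    unfolding det_def by (rule sum.reindex_bij_betw[OF bij, symmetric])
  also have "\<dots> = (\<Sum>p | p permutes UNIV. of_int (sign p) * (\<Prod>k\<in>UNIV. A $ f k $ f (p k)))"
  proof (rule sum.cong)
    fix p :: "'m \<Rightarrow> 'm" assume "p \<in> {p. p permutes UNIV}"
    then have "sign (?\<Phi> p) = sign p" by (simp add: sign_map_permutation inj)
    moreover have "(\<Prod>i\<in>UNIV. A $ i $ ?\<Phi> p i) = (\<Prod>k\<in>UNIV. A $ f k $ ?\<Phi> p (f k))"
      by (rule prod.reindex_bij_betw[OF assms, symmetric])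
    ultimately show "of_int (sign (?\<Phi> p)) * (\<Prod>i\<in>UNIV. A $ i $ ?\<Phi> p i)
        = of_int (sign p) * (\<Prod>k\<in>UNIV. A $ f k $ f (p k))"
      by (simp add: app)
  qed simp
  finally show ?thesis by (simp add: det_def)
qed

lemma reindex_axis:
  assumes "bij f"
  shows "reindex (inv f) (axis l 1) = axis (f l) 1"
  using assms by (auto simp: vec_eq_iff axis_def bij_is_inj bij_is_surj surj_f_inv_f)

text \<open>The formula for an injective differentiable map, carried over to an arbitrary finite index type. As \<open>f\<close>
  vanishes off the image of the box, its integral over the image is its integral over
  any larger box; this spares any discussion of the shape of the image.\<close>

lemma change_of_variables_cbox:
  fixes u :: "real^'n \<Rightarrow> real^'n" and f :: "real^'n \<Rightarrow> real"
  assumes der: "\<And>x. x \<in> cbox a b \<Longrightarrow> (u has_derivative u' x) (at x)"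
    and inj: "inj_on u (cbox a b)"
    and sub: "u ` cbox a b \<subseteq> cbox c d"
    and cont: "continuous_on (cbox c d) f"
    and zero: "\<And>y. y \<notin> u ` cbox a b \<Longrightarrow> f y = 0"
  shows "((\<lambda>x. \<bar>det (matrix (u' x))\<bar> * f (u x)) has_integral integral (cbox c d) f) (cbox a b)"
proof -
  obtain \<iota> :: "'n ranked \<Rightarrow> 'n" where \<iota>: "bij \<iota>" using ex_bij_ranked by blast
  have \<iota>': "bij (inv \<iota>)" using \<iota> by (rule bij_imp_bij_inv)
  define R where "R = reindex \<iota>"
  define R' where "R' = reindex (inv \<iota>)"
  have RR' [simp]: "R (R' y) = y" "R' (R x) = x" for x y
    using reindex_inv[OF \<iota>] by (auto simp: R_def R'_def)
  have boxR: "cbox (R p) (R q) = R ` cbox p q" for p q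
    using reindex_cbox[OF \<iota>] by (auto simp: R_def)
  have blR: "bounded_linear R" and blR': "bounded_linear R'"
    by (auto simp: R_def R'_def bounded_linear_reindex)
  let ?S = "cbox (R a) (R b)"
  \<comment> \<open>The general formula is vector valued, so the scalar integrand travels as a vector with one entry.\<close>
  let ?F = "\<lambda>y. vec (f (R' y)) :: real^1"
  let ?u = "\<lambda>x. R (u (R' x))"
  let ?u' = "\<lambda>x. R \<circ> u' (R' x) \<circ> R'"
  have inS: "R' x \<in> cbox a b" if "x \<in> ?S" for x
    using that unfolding boxR by auto
  have hasf: "(f has_integral integral (cbox c d) f) (cbox c d)"
    using cont by (simp add: integrable_continuous integrable_integral)
  have "continuous_on (cbox (R c) (R d)) (\<lambda>y. f (R' y))"
    by (rule continuous_on_compose2[OF cont linear_continuous_on[OF blR']]) (auto simp: boxR)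
  then have contF: "continuous_on (cbox (R c) (R d)) ?F"
    by (simp add: continuous_on_vec_lambda vec_def)
  have zeroF: "?F y = 0" if "y \<notin> ?u ` ?S" for y
  proof -
    have "R' y \<notin> u ` cbox a b"
    proof
      assume "R' y \<in> u ` cbox a b"
      then obtain x where x: "x \<in> cbox a b" "R' y = u x" by auto
      then have "y = ?u (R x)" "R x \<in> ?S" by (auto simp: boxR) (metis RR'(1))
      then show False using that by blast
    qed
    then show ?thesis using zero by (simp add: vec_eq_iff)
  qed
  have subF: "?u ` ?S \<subseteq> cbox (R c) (R d)"
    using sub by (auto simp: boxR)
  have absF: "?F absolutely_integrable_on (cbox (R c) (R d))"
    using contF by (rule absolutely_integrable_continuous)
  have eqF: "integral (?u ` ?S) ?F = integral (cbox (R c) (R d)) ?F"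
    by (rule integral_spike_set; rule negligible_subset[of "{}"]) (use zeroF subF in blast)+
  have absF': "?F absolutely_integrable_on (?u ` ?S)"
    by (rule absolutely_integrable_spike_set_eq[THEN iffD1, OF _ _ absF];
        rule negligible_subset[of "{}"]) (use zeroF subF in blast)+
  have "((\<lambda>y. f (R' y)) has_integral integral (cbox c d) f) (cbox (R c) (R d))"
    unfolding R'_def R_def
    by (rule has_integral_reindex[OF \<iota>']) (use hasf in \<open>simp add: reindex_inv[OF \<iota>]\<close>)
  then have "(?F has_integral vec (integral (cbox c d) f)) (cbox (R c) (R d))"
    by (simp add: has_integral_componentwise_iff[where f="?F"] Basis_vec_def inner_axis)
  then have valF: "integral (?u ` ?S) ?F = vec (integral (cbox c d) f)"
    using eqF by (simp add: integral_unique)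
  have "(\<lambda>x. \<bar>det (matrix (?u' x))\<bar> *\<^sub>R ?F (?u x)) absolutely_integrable_on ?S \<and>
        integral ?S (\<lambda>x. \<bar>det (matrix (?u' x))\<bar> *\<^sub>R ?F (?u x)) = vec (integral (cbox c d) f)"
  proof (rule has_absolute_integral_change_of_variables[THEN iffD2])
    show "?S \<in> sets lebesgue" by simp
    show "inj_on ?u ?S"
      by (rule inj_onI) (metis RR' inS inj inj_onD)
    show "(?u has_derivative ?u' x) (at x within ?S)" if "x \<in> ?S" for x
    proof -
      have "(u has_derivative u' (R' x)) (at (R' x))" by (rule der[OF inS[OF that]])
      from has_derivative_compose[OF bounded_linear_imp_has_derivative[OF blR', of "at x within ?S"] this]
      have "((\<lambda>x. u (R' x)) has_derivative (\<lambda>h. u' (R' x) (R' h))) (at x within ?S)" .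
      from bounded_linear.has_derivative[OF blR this]
      show ?thesis by (simp add: o_def)
    qed
    show "?F absolutely_integrable_on ?u ` ?S \<and> integral (?u ` ?S) ?F = vec (integral (cbox c d) f)"
      using absF' valF by simp
  qed
  then have "((\<lambda>x. \<bar>det (matrix (?u' x))\<bar> *\<^sub>R ?F (?u x)) has_integral vec (integral (cbox c d) f)) ?S"
    by (auto simp: has_integral_iff dest: set_lebesgue_integral_eq_integral(1))
  then have "((\<lambda>x. (\<bar>det (matrix (?u' x))\<bar> *\<^sub>R ?F (?u x)) $ 1) has_integral
      (vec (integral (cbox c d) f) :: real^1) $ 1) ?S"
    by (rule has_integral_linear[OF _ bounded_linear_vec_nth, unfolded o_def])
  then have "((\<lambda>x. \<bar>det (matrix (?u' x))\<bar> * f (u (R' x))) has_integral integral (cbox c d) f)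
      (cbox (reindex \<iota> a) (reindex \<iota> b))"
    by (simp flip: R_def)
  from has_integral_reindex[OF \<iota> this]
  have *: "((\<lambda>x. \<bar>det (matrix (?u' (R x)))\<bar> * f (u x)) has_integral integral (cbox c d) f) (cbox a b)"
    by (simp flip: R_def)
  have "det (matrix (R \<circ> u' x \<circ> R')) = det (matrix (u' x))" for x
  proof -
    have "matrix (R \<circ> u' x \<circ> R') = (\<chi> k l. matrix (u' x) $ \<iota> k $ \<iota> l)"
      by (simp add: vec_eq_iff matrix_def R_def R'_def reindex_axis[OF \<iota>] del: RR')
    then show ?thesis using det_reindex[OF \<iota>, of "matrix (u' x)"] by (rule trans[OF arg_cong])
  qed
  with * show ?thesis by simp
qed

section \<open>Continuously differentiable functions and bumps\<close>

lemma linear_sum_axis: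
  fixes f :: "real^'n \<Rightarrow> 'b::real_vector"
  assumes "linear f"
  shows "f z = (\<Sum>k\<in>UNIV. z $ k *\<^sub>R f (axis k 1))"
proof -
  have "f z = f (\<Sum>k\<in>UNIV. z $ k *\<^sub>R axis k 1)"
    by (simp add: basis_expansion flip: scalar_mult_eq_scaleR)
  also have "\<dots> = (\<Sum>k\<in>UNIV. z $ k *\<^sub>R f (axis k 1))"
    using assms by (simp add: linear_sum linear_scale)
  finally show ?thesis .
qed

lemma C1_onI:
  assumes "\<And>x. x \<in> S \<Longrightarrow> (f has_derivative f' x) (at x)"
    and "\<And>v. continuous_on S (\<lambda>x. f' x v)"
  shows "C1_on f S"
proof -
  have "frechet_derivative f (at x) = f' x" if "x \<in> S" for x
    using assms(1)[OF that] by (rule frechet_derivative_at[symmetric])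
  then have "continuous_on S (\<lambda>x. frechet_derivative f (at x) v)" for v
    using assms(2)[of v] by (metis (mono_tags, lifting) continuous_on_cong)
  then show ?thesis
    using assms(1) by (auto simp: C1_on_def differentiable_def)
qed

lemma C1_on_imp_has_derivative:
  assumes "C1_on f S" "x \<in> S"
  shows "(f has_derivative frechet_derivative f (at x)) (at x)"
  using assms by (auto simp: C1_on_def frechet_derivative_works)

lemma C1_on_imp_continuous_on:
  assumes "C1_on f S"
  shows "continuous_on S f"
  using assms by (auto simp: C1_on_def intro!: continuous_at_imp_continuous_on differentiable_imp_continuous_within)

lemma C1_on_subset: "C1_on f S \<Longrightarrow> T \<subseteq> S \<Longrightarrow> C1_on f T"
  by (auto simp: C1_on_def intro: continuous_on_subset)

text \<open>The definition asks only for continuous partial derivatives; expanding the direction in coordinates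
  gives continuity along any continuous field of directions.\<close>

lemma C1_on_continuous_on_derivative:
  assumes "C1_on f S" "continuous_on S v"
  shows "continuous_on S (\<lambda>x. frechet_derivative f (at x) (v x))"
proof -
  have "continuous_on S (\<lambda>x. \<Sum>k\<in>UNIV. v x $ k *\<^sub>R frechet_derivative f (at x) (axis k 1))"
    using assms by (auto simp: C1_on_def intro!: continuous_intros)
  moreover have "frechet_derivative f (at x) (v x)
      = (\<Sum>k\<in>UNIV. v x $ k *\<^sub>R frechet_derivative f (at x) (axis k 1))" if "x \<in> S" for x
    using C1_on_imp_has_derivative[OF assms(1) that]
    by (intro linear_sum_axis has_derivative_linear)
  ultimately show ?thesis by (metis (mono_tags, lifting) continuous_on_cong)
qed

lemma C1_on_const: "C1_on (\<lambda>x. c) S"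
  by (rule C1_onI[where f' = "\<lambda>x h. 0"]) auto

lemma C1_on_mult:
  fixes f g :: "real^'n \<Rightarrow> real"
  assumes "C1_on f S" "C1_on g S"
  shows "C1_on (\<lambda>x. f x * g x) S"
proof (rule C1_onI)
  show "((\<lambda>x. f x * g x) has_derivative
      (\<lambda>h. f x * frechet_derivative g (at x) h + frechet_derivative f (at x) h * g x)) (at x)"
    if "x \<in> S" for x
    using assms[THEN C1_on_imp_has_derivative, OF that] by (rule has_derivative_mult)
  show "continuous_on S (\<lambda>x. f x * frechet_derivative g (at x) v + frechet_derivative f (at x) v * g x)" for v
    using assms[THEN C1_on_imp_continuous_on] assms[THEN C1_on_continuous_on_derivative, of "\<lambda>_. v"]
    by (intro continuous_intros) auto
qed

lemma C1_on_compose_real: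
  fixes f :: "real^'n \<Rightarrow> real" and g :: "real \<Rightarrow> real"
  assumes f: "C1_on f S" and g: "\<And>x. x \<in> S \<Longrightarrow> (g has_real_derivative g' (f x)) (at (f x))"
    and g': "continuous_on (f ` S) g'"
  shows "C1_on (\<lambda>x. g (f x)) S"
proof (rule C1_onI)
  show "((\<lambda>x. g (f x)) has_derivative (\<lambda>h. g' (f x) * frechet_derivative f (at x) h)) (at x)"
    if "x \<in> S" for x
    using has_derivative_compose[OF C1_on_imp_has_derivative[OF f that] g[OF that, unfolded has_field_derivative_def]] .
  show "continuous_on S (\<lambda>x. g' (f x) * frechet_derivative f (at x) v)" for v
    using C1_on_imp_continuous_on[OF f] C1_on_continuous_on_derivative[OF f, of "\<lambda>_. v"]
      continuous_on_compose[OF _ g']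
    by (auto intro!: continuous_intros simp: o_def)
qed

lemma frechet_derivative_cong_open:
  assumes "open B" "x \<in> B" "\<And>y. y \<in> B \<Longrightarrow> f y = g y"
  shows "frechet_derivative f (at x) = frechet_derivative g (at x)"
proof -
  have "(f has_derivative D) (at x) \<longleftrightarrow> (g has_derivative D) (at x)" for D
    using assms by (metis has_derivative_transform_within_open)
  then show ?thesis by (simp add: frechet_derivative_def)
qed

text \<open>\<open>B\<close> and the complement of \<open>S\<close> are open and cover the space, and the extension is continuously differentiable
  on each. Test functions built from \<open>u\<close> are defined near their support only and need this extension.\<close>

lemma C1_on_extend_zero:
  fixes f :: "real^'n \<Rightarrow> 'b::real_normed_vector"
  assumes "open B" "closed S" "S \<subseteq> B" "C1_on f B" and zero: "\<And>x. x \<in> B - S \<Longrightarrow> f x = 0"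
  shows "C1_on (\<lambda>x. if x \<in> B then f x else 0) UNIV" (is "C1_on ?F UNIV")
proof -
  let ?D = "\<lambda>x. if x \<in> B then frechet_derivative f (at x) else (\<lambda>h. 0)"
  have opn: "open (- S)" using assms(2) by auto
  have out: "(?F has_derivative (\<lambda>h. 0)) (at x)" if "x \<in> - S" for x
    by (rule has_derivative_transform_within_open[OF has_derivative_const opn that])
       (use zero in auto)
  have ins: "(?F has_derivative frechet_derivative f (at x)) (at x)" if "x \<in> B" for x
    by (rule has_derivative_transform_within_open[OF C1_on_imp_has_derivative[OF assms(4) that] assms(1) that]) auto
  have D0: "?D x = (\<lambda>h. 0)" if "x \<in> - S" for x
  proof (cases "x \<in> B")
    case True
    then show ?thesis using has_derivative_unique[OF ins[OF True] out[OF that]] by simp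
  qed simp
  have cov: "B \<union> - S = UNIV" using assms(3) by auto
  show ?thesis
  proof (rule C1_onI[where f' = ?D])
    show "(?F has_derivative ?D x) (at x)" for x
      using ins[of x] out[of x] assms(3) by auto
    fix v
    have "continuous_on B (\<lambda>x. ?D x v)"
      using C1_on_continuous_on_derivative[OF assms(4), of "\<lambda>_. v"] by simp
    moreover have "continuous_on (- S) (\<lambda>x. ?D x v)"
      by (rule continuous_on_eq[OF continuous_on_const[of _ 0]]) (rule D0[THEN fun_cong, symmetric])
    ultimately show "continuous_on UNIV (\<lambda>x. ?D x v)"
      unfolding cov[symmetric] by (rule continuous_on_open_Un[OF assms(1) opn])
  qed
qed

lemma has_real_derivative_max0_square:
  "((\<lambda>t. (max 0 t)\<^sup>2) has_real_derivative 2 * max 0 t) (at t)"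
proof (cases "t = 0")
  case True
  \<comment> \<open>Only the origin is delicate: there the difference quotient is bounded by the increment.\<close>
  have "(\<lambda>h. (max 0 h)\<^sup>2 / h) \<midarrow>0\<rightarrow> (0::real)"
  proof (rule tendsto_0_le[where K=1 and f="\<lambda>h. h"])
    have "\<bar>(max 0 h)\<^sup>2 / h\<bar> \<le> \<bar>h\<bar>" for h :: real
      by (cases "h > 0") (auto simp: max_def power2_eq_square)
    then show "\<forall>\<^sub>F h in at (0::real). norm ((max 0 h)\<^sup>2 / h) \<le> norm h * (1::real)"
      by (intro always_eventually) simp
  qed (auto intro: tendsto_ident_at)
  then show ?thesis using True by (simp add: DERIV_def)
next
  case False
  then consider "t < 0" | "t > 0" by linarith
  then show ?thesis
  proof cases
    case 1
    show ?thesis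
      by (rule has_field_derivative_transform_within_open[where S="{..<0}" and f="\<lambda>_. 0"])
         (use 1 in \<open>auto simp: max_def\<close>)
  next
    case 2
    show ?thesis
      by (rule has_field_derivative_transform_within_open[where S="{0<..}" and f="\<lambda>t. t\<^sup>2"])
         (use 2 in \<open>auto intro!: derivative_eq_intros simp: max_def\<close>)
  qed
qed

lemma C1_on_max0_square:
  fixes f :: "real^'n \<Rightarrow> real"
  assumes "C1_on f S"
  shows "C1_on (\<lambda>x. (max 0 (f x))\<^sup>2) S"
  by (rule C1_on_compose_real[OF assms has_real_derivative_max0_square]) (auto intro!: continuous_intros)

text \<open>A radial profile that is positive exactly on the ball of radius \<open>r\<close> about \<open>y\<close>. Squaring the positive part
  is what makes it continuously differentiable across the sphere, and being polynomial inside
  it has an explicit derivative, jointly continuous in \<open>x\<close> and \<open>y\<close>.\<close>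

definition bump :: "'a::real_inner \<Rightarrow> real \<Rightarrow> 'a \<Rightarrow> real" where
  "bump y r x = (max 0 (r\<^sup>2 - (x - y) \<bullet> (x - y)))\<^sup>2"

definition bump_deriv :: "'a::real_inner \<Rightarrow> real \<Rightarrow> 'a \<Rightarrow> 'a \<Rightarrow> real" where
  "bump_deriv y r x h = - 4 * max 0 (r\<^sup>2 - (x - y) \<bullet> (x - y)) * ((x - y) \<bullet> h)"

lemma bump_has_derivative: "(bump y r has_derivative bump_deriv y r x) (at x)"
proof -
  have "((\<lambda>x. r\<^sup>2 - (x - y) \<bullet> (x - y)) has_derivative (\<lambda>h. - 2 * ((x - y) \<bullet> h))) (at x)"
    by (auto intro!: derivative_eq_intros simp: inner_commute)
  from has_derivative_compose[OF this has_real_derivative_max0_square[unfolded has_field_derivative_def]]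
  show ?thesis
    by (simp add: bump_def[abs_def] bump_deriv_def[abs_def] mult.assoc)
qed

lemma bump_nonneg: "0 \<le> bump y r x"
  by (simp add: bump_def)

lemma bump_pos_iff:
  assumes "r > 0"
  shows "0 < bump y r x \<longleftrightarrow> x \<in> ball y r"
proof -
  have "x \<in> ball y r \<longleftrightarrow> (norm (x - y))\<^sup>2 < r\<^sup>2"
    using assms power2_less_imp_less[of "norm (x - y)" r] power_strict_mono[of "norm (x - y)" r 2]
    by (auto simp: dist_norm norm_minus_commute)
  then show ?thesis
    by (auto simp: bump_def power2_norm_eq_inner max_def)
qed

lemma bump_eq_0_iff: "r > 0 \<Longrightarrow> bump y r x = 0 \<longleftrightarrow> x \<notin> ball y r"
  using bump_pos_iff[of r y x] bump_nonneg[of y r x] by linarith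

lemma bump_deriv_outside: "r > 0 \<Longrightarrow> x \<notin> ball y r \<Longrightarrow> bump_deriv y r x h = 0"
  using bump_eq_0_iff[of r y x] by (simp add: bump_def bump_deriv_def)

lemma continuous_on_bump [continuous_intros]:
  "continuous_on S f \<Longrightarrow> continuous_on S g \<Longrightarrow> continuous_on S (\<lambda>x. bump (f x) r (g x))"
  unfolding bump_def by (intro continuous_intros)

lemma continuous_on_bump_deriv [continuous_intros]:
  "continuous_on S f \<Longrightarrow> continuous_on S g \<Longrightarrow> continuous_on S h \<Longrightarrow>
    continuous_on S (\<lambda>x. bump_deriv (f x) r (g x) (h x))"
  unfolding bump_deriv_def by (intro continuous_intros)

lemma C1_on_bump: "C1_on (bump (y::real^'n) r) S"
  by (rule C1_onI[OF bump_has_derivative]) (intro continuous_intros)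

section \<open>Integration by parts and the fundamental lemma\<close>

lemma absolutely_integrable_on_mult_continuous:
  fixes f g :: "'a::euclidean_space \<Rightarrow> real"
  assumes "compact K" "continuous_on K f" "g absolutely_integrable_on K"
  shows "(\<lambda>x. f x * g x) absolutely_integrable_on K"
proof (rule absolutely_integrable_bounded_measurable_product[OF bilinear_times _ _ _ assms(3)])
  show K: "K \<in> sets lebesgue" using assms(1) by (simp add: lmeasurable_compact fmeasurableD)
  show "f \<in> borel_measurable (lebesgue_on K)"
    using assms(2) K by (rule continuous_imp_measurable_on_sets_lebesgue)
  show "bounded (f ` K)"
    using assms(1,2) by (intro compact_imp_bounded compact_continuous_image)
qed

lemma absolutely_integrable_on_compact_continuous:
  fixes f :: "'a::euclidean_space \<Rightarrow> real"
  assumes "compact K" "continuous_on K f"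
  shows "f absolutely_integrable_on K"
  using absolutely_integrable_on_mult_continuous[OF assms, of "\<lambda>_. 1"] assms(1)
  by (simp add: absolutely_integrable_on_const lmeasurable_compact)

lemma set_lebesgue_integral_eq_integral_subset:
  fixes f :: "'a::euclidean_space \<Rightarrow> real"
  assumes "f absolutely_integrable_on K" "K \<subseteq> S" "\<And>x. x \<in> S - K \<Longrightarrow> f x = 0"
  shows "(LINT x:S|lebesgue. f x) = integral K f"
proof -
  have "(LINT x:S|lebesgue. f x) = (LINT x:K|lebesgue. f x)"
    unfolding set_lebesgue_integral_def
    by (rule Bochner_Integration.integral_cong) (use assms(2,3) in \<open>auto simp: indicator_def\<close>)
  then show ?thesis using assms(1) by (simp add: set_lebesgue_integral_eq_integral(2))
qed

text \<open>The integral of \<open>P (x + s v)\<close> over a box that contains all the translated supports does not depend on \<open>s\<close>.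
  Its derivative at \<open>s = 0\<close>, computed under the integral sign, is the integral of the directional derivative.
  This gives integration by parts without iterated integrals.\<close>

lemma has_integral_derivative_compact_support:
  fixes P :: "real^'n \<Rightarrow> real"
  assumes C1: "C1_on P UNIV" and K: "compact K" and zero: "\<And>x. x \<notin> K \<Longrightarrow> P x = 0"
  shows "((\<lambda>x. frechet_derivative P (at x) v) has_integral 0) UNIV"
proof -
  let ?D = "\<lambda>x. frechet_derivative P (at x) v"
  have "bounded ((\<lambda>(x, s). x + s *\<^sub>R v) ` (K \<times> {-1..1}))"
    using K by (intro compact_imp_bounded compact_continuous_image compact_Times)
               (auto intro!: continuous_intros simp: case_prod_beta)
  then obtain c where c: "(\<lambda>(x, s). x + s *\<^sub>R v) ` (K \<times> {-1..1}) \<subseteq> cbox (- c) c"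
    by (rule bounded_subset_cbox_symmetric)
  have big: "x \<in> cbox (- c + s *\<^sub>R v) (c + s *\<^sub>R v)" if "x \<in> K" "s \<in> {-1..1}" for x s
  proof -
    have "x + (- s) *\<^sub>R v \<in> cbox (- c) c"
      using c that by (auto dest!: subsetD[OF _ imageI[of "(x, - s)"]])
    then show ?thesis by (auto simp: mem_box inner_simps algebra_simps)
  qed
  have contP: "continuous_on S P" for S
    using C1_on_imp_continuous_on[OF C1_on_subset[OF C1]] by auto
  have contD: "continuous_on S ?D" for S
    using C1_on_continuous_on_derivative[OF C1, of "\<lambda>_. v"] continuous_on_subset by auto
  have const: "integral (cbox (- c) c) (\<lambda>x. P (x + s *\<^sub>R v)) = integral K P" if "s \<in> {-1..1}" for s
  proof -
    have "integral (cbox (- c) c) (\<lambda>x. P (x + s *\<^sub>R v)) = integral (cbox (- c + s *\<^sub>R v) (c + s *\<^sub>R v)) P"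
      using integral_shift_cbox_plus[of "- c" c P "s *\<^sub>R v"] by (simp add: o_def add.commute)
    also have "\<dots> = integral K P"
      by (rule integral_spike_set; rule negligible_subset[of "{}"]) (use zero big[OF _ that] in blast)+
    finally show ?thesis .
  qed
  have "((\<lambda>s. integral (cbox (- c) c) (\<lambda>x. P (x + s *\<^sub>R v))) has_vector_derivative
        integral (cbox (- c) c) (\<lambda>x. ?D (x + 0 *\<^sub>R v))) (at 0 within {-1..1})"
  proof (rule leibniz_rule_vector_derivative)
    fix s :: real and x assume "s \<in> {-1..1}"
    have "((\<lambda>s. P (x + s *\<^sub>R v)) has_derivative
        (\<lambda>h. frechet_derivative P (at (x + s *\<^sub>R v)) (h *\<^sub>R v))) (at s within {-1..1})"
      by (rule has_derivative_compose[OF _ C1_on_imp_has_derivative[OF C1]])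
         (auto intro!: derivative_eq_intros)
    then show "((\<lambda>s. P (x + s *\<^sub>R v)) has_vector_derivative ?D (x + s *\<^sub>R v)) (at s within {-1..1})"
      using has_derivative_linear[OF C1_on_imp_has_derivative[OF C1]]
      by (simp add: has_vector_derivative_def linear_scale)
  next
    show "(\<lambda>x. P (x + s *\<^sub>R v)) integrable_on cbox (- c) c" for s
      by (intro integrable_continuous continuous_on_compose2[OF contP]) (auto intro!: continuous_intros)
    show "continuous_on ({-1..1} \<times> cbox (- c) c) (\<lambda>(s, x). ?D (x + s *\<^sub>R v))"
      unfolding case_prod_beta
      by (intro continuous_on_compose2[OF contD]) (auto intro!: continuous_intros)
  qed auto
  moreover have "((\<lambda>s. integral (cbox (- c) c) (\<lambda>x. P (x + s *\<^sub>R v))) has_vector_derivative 0)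
      (at 0 within {-1..1})"
    by (rule has_vector_derivative_transform[OF _ const has_vector_derivative_const]) auto
  ultimately have "integral (cbox (- c) c) ?D = 0"
    by (intro vector_derivative_unique_within[of 0 "{-1..1::real}"])
       (simp_all add: at_within_Icc_at)
  then have "(?D has_integral 0) (cbox (- c) c)"
    using integrable_continuous[OF contD] by (metis has_integral_integral)
  moreover have "?D x = 0" if "x \<notin> cbox (- c) c" for x
  proof -
    have "y \<notin> K" if "y \<in> - cbox (- c) c" for y using that big[of y 0] by auto
    then have "frechet_derivative P (at x) = frechet_derivative (\<lambda>_. 0) (at x)"
      by (intro frechet_derivative_cong_open[of "- cbox (- c) c"]) (use that zero in auto)
    then show ?thesis by simp
  qed
  ultimately show ?thesis by (rule has_integral_on_superset) auto
qed

text \<open>These sets serve as the generating system in the fundamental lemma of the calculus of variations: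
  their indicators are monotone limits of continuously differentiable functions, products of functions
  give intersections of sets, and half-spaces are among them.\<close>

definition C1_cozero_sets :: "(real^'n) set set" where
  "C1_cozero_sets = {{x. \<phi> x > 0} | \<phi> :: real^'n \<Rightarrow> real. C1_on \<phi> UNIV \<and> (\<forall>x. 0 \<le> \<phi> x)}"

lemma C1_cozero_setsE:
  fixes A :: "(real^'n) set"
  assumes "A \<in> C1_cozero_sets"
  obtains \<phi> :: "real^'n \<Rightarrow> real" where "A = {x. \<phi> x > 0}" "C1_on \<phi> UNIV" "\<forall>x. 0 \<le> \<phi> x"
  using assms unfolding C1_cozero_sets_def by auto

lemma Int_stable_C1_cozero_sets: "Int_stable C1_cozero_sets"
proof (rule Int_stableI)
  fix A B :: "(real^'n) set" assume "A \<in> C1_cozero_sets" "B \<in> C1_cozero_sets"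
  then obtain \<phi> \<psi> :: "real^'n \<Rightarrow> real" where "A = {x. \<phi> x > 0}" "C1_on \<phi> UNIV" "\<forall>x. 0 \<le> \<phi> x"
    "B = {x. \<psi> x > 0}" "C1_on \<psi> UNIV" "\<forall>x. 0 \<le> \<psi> x"
    by (metis C1_cozero_setsE)
  moreover from this have "0 < \<phi> x * \<psi> x \<longleftrightarrow> 0 < \<phi> x \<and> 0 < \<psi> x" for x
    by (metis less_le mult_eq_0_iff mult_nonneg_nonneg)
  ultimately show "A \<inter> B \<in> C1_cozero_sets"
    unfolding C1_cozero_sets_def
    by (intro CollectI exI[of _ "\<lambda>x. \<phi> x * \<psi> x"]) (auto intro: C1_on_mult)
qed

lemma open_C1_cozero_set: "A \<in> C1_cozero_sets \<Longrightarrow> open A"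
  unfolding C1_cozero_sets_def
  by (auto intro!: open_Collect_less dest: C1_on_imp_continuous_on)

lemma borel_eq_C1_cozero_sets: "sets (borel :: (real^'n) measure) = sigma_sets UNIV C1_cozero_sets"
proof
  have "{x. x \<bullet> i < a} \<in> C1_cozero_sets" for a and i :: "real^'n"
  proof -
    have "C1_on (\<lambda>x. a - x \<bullet> i) UNIV"
      by (rule C1_onI[where f' = "\<lambda>x h. - (h \<bullet> i)"]) (auto intro!: derivative_eq_intros)
    from C1_on_max0_square[OF this]
    have "{x. 0 < (max 0 (a - x \<bullet> i))\<^sup>2} \<in> C1_cozero_sets"
      unfolding C1_cozero_sets_def
      by (intro CollectI exI[of _ "\<lambda>x. (max 0 (a - x \<bullet> i))\<^sup>2"] conjI refl) auto
    moreover have "0 < (max 0 (a - x \<bullet> i))\<^sup>2 \<longleftrightarrow> x \<bullet> i < a" for x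
      by (auto simp: max_def)
    ultimately show ?thesis by simp
  qed
  then show "sets (borel :: (real^'n) measure) \<subseteq> sigma_sets UNIV C1_cozero_sets"
    unfolding borel_eq_halfspace_less by (auto intro!: sigma_sets_mono')
  show "sigma_sets UNIV C1_cozero_sets \<subseteq> sets (borel :: (real^'n) measure)"
  proof -
    have "C1_cozero_sets \<subseteq> sets (borel :: (real^'n) measure)"
      by (intro subsetI borel_open open_C1_cozero_set)
    from sets.sigma_sets_subset[OF this] show ?thesis by simp
  qed
qed

text \<open>The positive and the negative part of \<open>F\<close> are densities of two finite measures which agree on an
  intersection-stable generator of the Borel sets, hence everywhere.\<close>

lemma AE_zero_if_integral_C1_cozero_zero:
  fixes F :: "real^'n \<Rightarrow> real"
  assumes int: "integrable lborel F"
    and zero: "\<And>A. A \<in> C1_cozero_sets \<Longrightarrow> (LINT x|lborel. F x * indicator A x) = 0"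
  shows "AE x in lborel. F x = 0"
proof -
  have [measurable]: "F \<in> borel_measurable borel" using borel_measurable_integrable[OF int] by simp
  have [measurable]: "A \<in> sets borel" if "A \<in> C1_cozero_sets" for A :: "(real^'n) set"
    using open_C1_cozero_set[OF that] by simp
  \<comment> \<open>The sign parameter covers both parts at once: the conversion to extended reals cuts off negative values.\<close>
  define dens where "dens s = density lborel (\<lambda>x. ennreal (s * F x))" for s
  have em: "emeasure (dens s) A = ennreal (LINT x|lborel. max 0 (s * F x) * indicator A x)"
    if "A \<in> sets borel" for s A
  proof -
    have "emeasure (dens s) A = (\<integral>\<^sup>+x. ennreal (max 0 (s * F x) * indicator A x) \<partial>lborel)"
      unfolding dens_def using that
      by (subst emeasure_density) (auto intro!: nn_integral_cong simp: indicator_def ennreal_max_0)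
    also have "\<dots> = ennreal (LINT x|lborel. max 0 (s * F x) * indicator A x)"
      using that int by (intro nn_integral_eq_integral integrable_real_mult_indicator AE_I2) auto
    finally show ?thesis .
  qed
  have "dens 1 = dens (-1)"
  proof (rule measure_eqI_generator_eq[OF Int_stable_C1_cozero_sets, where A = "\<lambda>_. UNIV"])
    fix A :: "(real^'n) set" assume A: "A \<in> C1_cozero_sets"
    then have Ab: "A \<in> sets borel" by simp
    have "(LINT x|lborel. max 0 (1 * F x) * indicator A x) - (LINT x|lborel. max 0 (-1 * F x) * indicator A x)
       = (LINT x|lborel. max 0 (1 * F x) * indicator A x - max 0 (-1 * F x) * indicator A x)"
      using Ab int by (intro Bochner_Integration.integral_diff[symmetric] integrable_real_mult_indicator) auto
    also have "\<dots> = (LINT x|lborel. F x * indicator A x)"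
      by (rule Bochner_Integration.integral_cong) (auto simp: indicator_def max_def)
    also have "\<dots> = 0" by (rule zero[OF A])
    finally show "emeasure (dens 1) A = emeasure (dens (-1)) A"
      using em[OF Ab] by simp
  next
    have "{x :: real^'n. (1::real) > 0} \<in> C1_cozero_sets"
      unfolding C1_cozero_sets_def
      by (intro CollectI exI[of _ "\<lambda>_. 1::real"] conjI refl C1_on_const) simp
    then show "range (\<lambda>_. UNIV :: (real^'n) set) \<subseteq> C1_cozero_sets" by simp
    show "emeasure (dens 1) UNIV \<noteq> \<infinity>" using em[of UNIV 1] by simp
  qed (auto simp: dens_def borel_eq_C1_cozero_sets)
  then have "AE x in lborel. ennreal (1 * F x) = ennreal (-1 * F x)"
    unfolding dens_def by (intro sigma_finite_measure.density_unique[OF sigma_finite_lborel]) auto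
  then show ?thesis
  proof eventually_elim
    case (elim x)
    show ?case
    proof (cases "F x \<ge> 0")
      case True
      then have "ennreal (-1 * F x) = 0" by (intro ennreal_neg) simp
      then have "ennreal (1 * F x) = 0" using elim by (rule trans[rotated])
      then show ?thesis using True by (simp add: ennreal_eq_0_iff)
    next
      case False
      then have "ennreal (1 * F x) = 0" by (intro ennreal_neg) simp
      then have "ennreal (-1 * F x) = 0" using elim by simp
      then show ?thesis using False by (simp add: ennreal_eq_0_iff)
    qed
  qed
qed

text \<open>The fundamental lemma of the calculus of variations on a ball. For nonnegative \<open>\<theta>\<close> the functions
  \<open>k \<theta> / (1 + k \<theta>)\<close> are admissible tests that increase to the indicator of the set where \<open>\<theta>\<close> is positive, so
  dominated convergence passes from test functions to the sets of the generator.\<close>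

lemma negligible_if_orthogonal_to_C1:
  fixes f :: "real^'n \<Rightarrow> real"
  assumes f: "f absolutely_integrable_on cball c r" and "r > 0"
    and orth: "\<And>\<phi>. C1_on \<phi> UNIV \<Longrightarrow> (\<And>x. x \<notin> ball c r \<Longrightarrow> \<phi> x = 0) \<Longrightarrow>
      integral (cball c r) (\<lambda>x. \<phi> x * f x) = 0"
  shows "negligible {x \<in> ball c r. f x \<noteq> 0}"
proof -
  define F where "F x = indicator (ball c r) x * f x" for x
  have F: "integrable lebesgue F"
    using set_integrable_subset[OF f, of "ball c r"] unfolding F_def set_integrable_def by (simp add: fmeasurableD)
  have [measurable]: "F \<in> borel_measurable lebesgue" using F by auto
  have zero: "(LINT x|lebesgue. F x * indicator A x) = 0" if A_in: "A \<in> C1_cozero_sets" for A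
  proof -
    obtain \<phi> :: "real^'n \<Rightarrow> real" where A: "A = {x. \<phi> x > 0}" and \<phi>0: "C1_on \<phi> UNIV" "\<forall>x. 0 \<le> \<phi> x"
      using A_in by (rule C1_cozero_setsE)
    then have \<phi>: "C1_on \<phi> UNIV" "0 \<le> \<phi> x" for x by auto
    \<comment> \<open>The factor supported in the ball makes every test function below vanish off the ball.\<close>
    define \<theta> where "\<theta> x = bump c r x * \<phi> x" for x
    have \<theta>: "C1_on \<theta> UNIV" "0 \<le> \<theta> x" for x
      unfolding \<theta>_def using \<phi> by (auto intro!: C1_on_mult C1_on_bump bump_nonneg mult_nonneg_nonneg)
    define \<psi> where "\<psi> k x = real k * \<theta> x / (1 + real k * \<theta> x)" for k x
    have ge0: "0 \<le> real k * \<theta> x" for k x using \<theta>(2) by simp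
    have C1: "C1_on (\<psi> k) UNIV" for k
    proof -
      have "C1_on (\<lambda>x. (\<lambda>t. real k * t / (1 + real k * t)) (\<theta> x)) UNIV"
      proof (rule C1_on_compose_real[OF \<theta>(1), where g' = "\<lambda>t. real k / (1 + real k * t)\<^sup>2"])
        fix x :: "real^'n"
        have "1 + real k * \<theta> x \<noteq> 0" using ge0[of k x] by linarith
        then show "((\<lambda>t. real k * t / (1 + real k * t)) has_real_derivative real k / (1 + real k * \<theta> x)\<^sup>2) (at (\<theta> x))"
          by (auto intro!: derivative_eq_intros simp: power2_eq_square field_simps)
      next
        have "1 + real k * \<theta> x \<noteq> 0" for x using ge0[of k x] by linarith
        then show "continuous_on (range \<theta>) (\<lambda>t. real k / (1 + real k * t)\<^sup>2)"
          by (intro continuous_intros) auto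
      qed
      then show ?thesis by (simp add: \<psi>_def[abs_def])
    qed
    have le1: "\<bar>\<psi> k x\<bar> \<le> 1" for k x
      using ge0[of k x] by (simp add: \<psi>_def divide_le_eq abs_of_nonneg)
    have supp: "\<psi> k x = 0" if "x \<notin> ball c r" for k x
      using that bump_eq_0_iff[OF \<open>r > 0\<close>, of c x] by (simp add: \<psi>_def \<theta>_def)
    have [measurable]: "\<psi> k \<in> borel_measurable lebesgue" for k
      using C1_on_imp_continuous_on[OF C1] by (intro measurable_completion) (simp add: borel_measurable_continuous_onI)
    have "(\<lambda>k. LINT x|lebesgue. F x * \<psi> k x) \<longlonglongrightarrow> (LINT x|lebesgue. F x * indicator A x)"
    proof (rule integral_dominated_convergence[where w = "\<lambda>x. \<bar>F x\<bar>"])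
      have "open A" using A_in by (rule open_C1_cozero_set)
      then show "(\<lambda>x. F x * indicator A x) \<in> borel_measurable lebesgue"
        by (intro borel_measurable_times borel_measurable_indicator) auto
      show "AE x in lebesgue. (\<lambda>k. F x * \<psi> k x) \<longlonglongrightarrow> F x * indicator A x"
      proof (rule AE_I2)
        fix x
        show "(\<lambda>k. F x * \<psi> k x) \<longlonglongrightarrow> F x * indicator A x"
        proof (cases "x \<in> ball c r \<and> x \<in> A")
          case True
          then have pos: "\<theta> x > 0" using bump_pos_iff[OF \<open>r > 0\<close>, of c x] by (simp add: \<theta>_def A)
          have "(\<lambda>k. \<psi> k x) \<longlonglongrightarrow> 1"
            unfolding \<psi>_def using pos by real_asymp
          then show ?thesis using True by (auto intro!: tendsto_eq_intros)
        next
          case False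
          then have "F x * indicator A x = 0" "F x * \<psi> k x = 0" for k
            using supp[of x k] \<phi>(2)[of x] by (auto simp: F_def A \<psi>_def \<theta>_def)
          then show ?thesis by (simp only: tendsto_const)
        qed
      qed
      show "AE x in lebesgue. norm (F x * \<psi> k x) \<le> \<bar>F x\<bar>" for k
        using le1 by (auto intro!: AE_I2 mult_left_le simp: abs_mult)
    qed (use F in auto)
    moreover have "(LINT x|lebesgue. F x * \<psi> k x) = 0" for k
    proof -
      have "(LINT x|lebesgue. F x * \<psi> k x) = (LINT x:cball c r|lebesgue. \<psi> k x * f x)"
        unfolding set_lebesgue_integral_def
        by (rule Bochner_Integration.integral_cong) (use supp[of _ k] in \<open>auto simp: F_def indicator_def\<close>)
      also have "\<dots> = integral (cball c r) (\<lambda>x. \<psi> k x * f x)"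
        by (intro set_lebesgue_integral_eq_integral absolutely_integrable_on_mult_continuous f compact_cball
            C1_on_imp_continuous_on C1_on_subset[OF C1]) auto
      also have "\<dots> = 0" by (rule orth[OF C1 supp])
      finally show ?thesis .
    qed
    ultimately show ?thesis by (simp add: LIMSEQ_const_iff)
  qed
  obtain F' where F': "F' \<in> borel_measurable lborel" "AE x in lborel. F x = F' x"
    using completion_ex_borel_measurable_real[of F lborel] by auto
  have AEl: "AE x in lebesgue. F x = F' x" using F'(2) by (rule AE_completion)
  have [measurable]: "F' \<in> borel_measurable lebesgue" using F'(1) by (rule measurable_completion)
  have "AE x in lborel. F' x = 0"
  proof (rule AE_zero_if_integral_C1_cozero_zero)
    have "integrable lebesgue F'"
      using F AEl integrable_cong_AE[of F lebesgue F'] by simp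
    then show "integrable lborel F'" using F'(1) by (simp add: integrable_completion)
    fix A :: "(real^'n) set" assume A: "A \<in> C1_cozero_sets"
    have opn: "open A" by (rule open_C1_cozero_set[OF A])
    then have Ab: "A \<in> sets borel" "A \<in> sets lebesgue" by auto
    have "(LINT x|lborel. F' x * indicator A x) = (LINT x|lebesgue. F' x * indicator A x)"
      using F'(1) Ab by (intro integral_completion[symmetric]) simp
    also have "\<dots> = (LINT x|lebesgue. F x * indicator A x)"
      using AEl Ab(2) by (intro integral_cong_AE borel_measurable_times borel_measurable_indicator) auto
    also have "\<dots> = 0" by (rule zero[OF A])
    finally show "(LINT x|lborel. F' x * indicator A x) = 0" .
  qed
  with F'(2) have "AE x in lborel. F x = 0" by eventually_elim simp
  then have "AE x in lebesgue. F x = 0" by (rule AE_completion)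
  moreover have "{x \<in> space lebesgue. F x \<noteq> 0} \<in> sets lebesgue" by measurable
  ultimately have "{x. F x \<noteq> 0} \<in> null_sets lebesgue"
    by (simp add: AE_iff_null_sets)
  moreover have "{x. F x \<noteq> 0} = {x \<in> ball c r. f x \<noteq> 0}" by (auto simp: F_def split: split_indicator_asm)
  ultimately show ?thesis by (simp add: negligible_iff_null_sets)
qed

section \<open>The weak Jacobian of a continuously differentiable map\<close>

lemma C1_on_nth:
  fixes u :: "real^'n \<Rightarrow> real^'m"
  assumes "C1_on u S"
  shows "C1_on (\<lambda>x. u x $ i) S"
proof (rule C1_onI)
  show "((\<lambda>x. u x $ i) has_derivative (\<lambda>h. frechet_derivative u (at x) h $ i)) (at x)" if "x \<in> S" for x
    using bounded_linear.has_derivative[OF bounded_linear_vec_nth C1_on_imp_has_derivative[OF assms that]] .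
  show "continuous_on S (\<lambda>x. frechet_derivative u (at x) v $ i)" for v
    by (intro continuous_intros C1_on_continuous_on_derivative[OF assms])
qed

lemma jacobian_nth: "jacobian u (at x) $ i $ j = frechet_derivative u (at x) (axis j 1) $ i"
  by (simp add: jacobian_def matrix_def)

lemma C1_on_continuous_on_jacobian_nth:
  fixes u :: "real^'n \<Rightarrow> real^'m"
  assumes "C1_on u S"
  shows "continuous_on S (\<lambda>x. jacobian u (at x) $ i $ j)"
  unfolding jacobian_nth
  by (intro continuous_intros C1_on_continuous_on_derivative[OF assms])

lemma C1_on_continuous_on_det_jacobian:
  fixes u :: "real^'n \<Rightarrow> real^'n"
  assumes "C1_on u S"
  shows "continuous_on S (\<lambda>x. det (jacobian u (at x)))"
  unfolding det_def by (intro continuous_intros C1_on_continuous_on_jacobian_nth[OF assms])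

lemma C1c_onI:
  assumes "C1_on f \<Omega>" "compact K" "K \<subseteq> \<Omega>" "\<And>x. x \<in> \<Omega> - K \<Longrightarrow> f x = 0"
  shows "C1c_on f \<Omega>"
proof -
  have "closure {x \<in> \<Omega>. f x \<noteq> 0} \<subseteq> K"
    using assms(2,4) by (intro closure_minimal compact_imp_closed) auto
  then show ?thesis
    using assms compact_closure[of "{x \<in> \<Omega>. f x \<noteq> 0}"] bounded_subset[OF compact_imp_bounded[OF assms(2)]]
    by (auto simp: C1c_on_def) (meson closure_subset subset_trans)
qed

lemma frechet_derivative_eq_zero_outside:
  assumes "closed K" "\<And>x. x \<notin> K \<Longrightarrow> f x = 0" "x \<notin> K"
  shows "frechet_derivative f (at x) = (\<lambda>h. 0)"
proof -
  have "frechet_derivative f (at x) = frechet_derivative (\<lambda>_. 0) (at x)"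
    by (rule frechet_derivative_cong_open[of "- K"]) (use assms in auto)
  then show ?thesis by simp
qed

text \<open>The product of \<open>p\<close> and \<open>\<phi>\<close>, extended by zero, has compact support, so the integral of its derivative vanishes.\<close>

lemma integral_by_parts_C1:
  fixes p \<phi> :: "real^'n \<Rightarrow> real"
  assumes "open \<Omega>" "C1_on p \<Omega>" "C1_on \<phi> \<Omega>" "compact K" "K \<subseteq> \<Omega>"
    and zero: "\<And>x. x \<notin> K \<Longrightarrow> \<phi> x = 0"
  shows "integral K (\<lambda>x. p x * frechet_derivative \<phi> (at x) v)
       = - integral K (\<lambda>x. \<phi> x * frechet_derivative p (at x) v)"
proof -
  let ?P = "\<lambda>x. if x \<in> \<Omega> then p x * \<phi> x else 0"
  let ?D = "\<lambda>x. frechet_derivative ?P (at x) v"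
  have clK: "closed K" using assms(4) by (rule compact_imp_closed)
  have C1: "C1_on ?P UNIV"
    by (rule C1_on_extend_zero[OF assms(1) clK assms(5)]) (auto intro: C1_on_mult assms simp: zero)
  have outK: "?P x = 0" if "x \<notin> K" for x using zero[OF that] by simp
  have D: "?D x = p x * frechet_derivative \<phi> (at x) v + \<phi> x * frechet_derivative p (at x) v" if "x \<in> K" for x
  proof -
    have x: "x \<in> \<Omega>" using that assms(5) by auto
    have "((\<lambda>x. p x * \<phi> x) has_derivative (\<lambda>h. p x * frechet_derivative \<phi> (at x) h
        + frechet_derivative p (at x) h * \<phi> x)) (at x)"
      by (rule has_derivative_mult[OF assms(2,3)[THEN C1_on_imp_has_derivative, OF x]])
    then have "(?P has_derivative (\<lambda>h. p x * frechet_derivative \<phi> (at x) h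
        + frechet_derivative p (at x) h * \<phi> x)) (at x)"
      by (rule has_derivative_transform_within_open[OF _ assms(1) x]) simp
    from frechet_derivative_at[OF this, symmetric] show ?thesis by (simp only: mult.commute)
  qed
  have int: "(\<lambda>x. p x * frechet_derivative \<phi> (at x) v) integrable_on K"
            "(\<lambda>x. \<phi> x * frechet_derivative p (at x) v) integrable_on K"
    by (intro set_lebesgue_integral_eq_integral(1) absolutely_integrable_on_compact_continuous assms
        continuous_on_subset[OF _ assms(5)] continuous_on_mult C1_on_imp_continuous_on
        C1_on_continuous_on_derivative continuous_on_const)+
  have D0: "?D x = 0" if "x \<notin> K" for x
    using frechet_derivative_eq_zero_outside[OF clK outK that] by simp
  have "integral K ?D = integral UNIV ?D"
    by (rule integral_spike_set; rule negligible_subset[of "{}"]) (use D0 in blast)+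
  also have "\<dots> = 0"
    using has_integral_derivative_compact_support[OF C1 assms(4) outK] by (rule integral_unique)
  finally have D_int: "integral K ?D = 0" .
  have "integral K ?D = integral K (\<lambda>x. p x * frechet_derivative \<phi> (at x) v + \<phi> x * frechet_derivative p (at x) v)"
    by (rule Henstock_Kurzweil_Integration.integral_cong) (rule D)
  with D_int have "integral K (\<lambda>x. p x * frechet_derivative \<phi> (at x) v + \<phi> x * frechet_derivative p (at x) v) = 0"
    by (rule trans[OF sym, rotated])
  then show ?thesis
    using int by (simp add: Henstock_Kurzweil_Integration.integral_add)
qed

text \<open>Integration by parts shows that the classical Jacobian satisfies the equations that define the weak one.
  Hence each entry of the difference is orthogonal to all test functions supported in the ball.\<close>

lemma weak_jacobian_eq_jacobian:
  fixes u :: "real^'n \<Rightarrow> real^'n"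
  assumes "open \<Omega>" and u: "C1_on u \<Omega>" and G: "L1loc_on G \<Omega>" "weak_jacobian_on u G \<Omega>"
    and c: "cball c r \<subseteq> \<Omega>" "r > 0"
  shows "negligible {x \<in> ball c r. G x \<noteq> jacobian u (at x)}"
proof -
  let ?d = "\<lambda>i j x. G x $ i $ j - jacobian u (at x) $ i $ j"
  let ?K = "cball c r"
  have Gij: "(\<lambda>x. G x $ i $ j) absolutely_integrable_on ?K" for i j
  proof -
    have "(\<lambda>x. G x \<bullet> axis i (axis j 1)) absolutely_integrable_on ?K"
      using G(1) c(1) by (intro absolutely_integrable_component) (auto simp: L1loc_on_def)
    then show ?thesis by (simp add: inner_axis)
  qed
  have Jij: "continuous_on ?K (\<lambda>x. jacobian u (at x) $ i $ j)" for i j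
    by (rule continuous_on_subset[OF C1_on_continuous_on_jacobian_nth[OF u] c(1)])
  have Jint: "(\<lambda>x. jacobian u (at x) $ i $ j) absolutely_integrable_on ?K" for i j
    using Jij by (intro absolutely_integrable_on_compact_continuous) auto
  have "negligible {x \<in> ball c r. ?d i j x \<noteq> 0}" for i j
  proof (rule negligible_if_orthogonal_to_C1[OF _ c(2)])
    show "?d i j absolutely_integrable_on ?K"
      using Gij Jint by (rule set_integral_diff)
    fix \<phi> :: "real^'n \<Rightarrow> real" assume \<phi>: "C1_on \<phi> UNIV" "\<And>x. x \<notin> ball c r \<Longrightarrow> \<phi> x = 0"
    have \<phi>\<Omega>: "C1_on \<phi> \<Omega>" using \<phi>(1) C1_on_subset by blast
    have out: "\<phi> x = 0" if "x \<notin> ?K" for x using \<phi>(2) that by auto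
    have cont\<phi>: "continuous_on ?K \<phi>"
      using C1_on_imp_continuous_on[OF \<phi>\<Omega>] c(1) by (rule continuous_on_subset)
    have "C1c_on \<phi> \<Omega>"
      by (rule C1c_onI[OF \<phi>\<Omega> compact_cball c(1)]) (use out in auto)
    then have w: "(LINT x:\<Omega>|lebesgue. u x $ i * frechet_derivative \<phi> (at x) (axis j 1)) =
               - (LINT x:\<Omega>|lebesgue. G x $ i $ j * \<phi> x)"
      using G(2) by (auto simp: weak_jacobian_on_def)
    have D: "continuous_on ?K (\<lambda>x. u x $ i * frechet_derivative \<phi> (at x) (axis j 1))"
      by (intro continuous_on_subset[OF _ c(1)] continuous_on_mult C1_on_continuous_on_derivative[OF \<phi>\<Omega>]
            C1_on_imp_continuous_on[OF C1_on_nth[OF u]] continuous_on_const)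
    have \<phi>'0: "frechet_derivative \<phi> (at x) (axis j 1) = 0" if "x \<notin> ?K" for x
      using frechet_derivative_eq_zero_outside[OF closed_cball out that] by simp
    have 1: "(LINT x:\<Omega>|lebesgue. u x $ i * frechet_derivative \<phi> (at x) (axis j 1))
        = integral ?K (\<lambda>x. u x $ i * frechet_derivative \<phi> (at x) (axis j 1))"
      by (rule set_lebesgue_integral_eq_integral_subset[OF absolutely_integrable_on_compact_continuous[OF _ D] c(1)])
         (use \<phi>'0 in auto)
    have G\<phi>: "(\<lambda>x. \<phi> x * G x $ i $ j) absolutely_integrable_on ?K"
      by (rule absolutely_integrable_on_mult_continuous[OF _ cont\<phi> Gij]) simp
    have 2: "(LINT x:\<Omega>|lebesgue. G x $ i $ j * \<phi> x) = integral ?K (\<lambda>x. \<phi> x * G x $ i $ j)"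
      unfolding mult.commute[of _ "\<phi> _"]
      by (rule set_lebesgue_integral_eq_integral_subset[OF G\<phi> c(1)]) (use out in auto)
    have "frechet_derivative (\<lambda>x. u x $ i) (at x) (axis j 1) = jacobian u (at x) $ i $ j" if "x \<in> ?K" for x
    proof -
      have "x \<in> \<Omega>" using that c(1) by auto
      from frechet_derivative_at[OF bounded_linear.has_derivative[OF bounded_linear_vec_nth C1_on_imp_has_derivative[OF u this], of i]]
      show ?thesis by (metis jacobian_nth)
    qed
    then have 3: "integral ?K (\<lambda>x. \<phi> x * frechet_derivative (\<lambda>x. u x $ i) (at x) (axis j 1))
        = integral ?K (\<lambda>x. \<phi> x * jacobian u (at x) $ i $ j)"
      by (intro Henstock_Kurzweil_Integration.integral_cong) simp
    have "integral ?K (\<lambda>x. u x $ i * frechet_derivative \<phi> (at x) (axis j 1))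
        = - integral ?K (\<lambda>x. \<phi> x * jacobian u (at x) $ i $ j)"
      using integral_by_parts_C1[OF assms(1) C1_on_nth[OF u] \<phi>\<Omega> compact_cball c(1) out, of i "axis j 1"] 3
      by simp
    with w 1 2 have eq: "integral ?K (\<lambda>x. \<phi> x * G x $ i $ j) = integral ?K (\<lambda>x. \<phi> x * jacobian u (at x) $ i $ j)"
      by simp
    have J\<phi>: "(\<lambda>x. \<phi> x * jacobian u (at x) $ i $ j) absolutely_integrable_on ?K"
      by (rule absolutely_integrable_on_mult_continuous[OF _ cont\<phi> Jint]) simp
    show "integral ?K (\<lambda>x. \<phi> x * ?d i j x) = 0"
      using eq Henstock_Kurzweil_Integration.integral_diff[OF G\<phi>[THEN set_lebesgue_integral_eq_integral(1)]
          J\<phi>[THEN set_lebesgue_integral_eq_integral(1)]]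
      by (simp add: right_diff_distrib)
  qed
  then have "negligible (\<Union>(i, j)\<in>UNIV. {x \<in> ball c r. ?d i j x \<noteq> 0})"
    by (intro negligible_Union) auto
  then show ?thesis
    by (rule negligible_subset) (auto simp: vec_eq_iff)
qed

section \<open>Testing the equation with functions of the solution\<close>

text \<open>For \<open>\<zeta> x = \<psi> (u x) v\<close> with scalar \<open>\<psi>\<close> the chain rule gives the rank one matrix \<open>D\<zeta> = v \<otimes> (D\<psi> Du)\<close>. Since
  \<open>cof A\<close> times the transpose of \<open>A\<close> is \<open>det A\<close> times the identity, the pairing with \<open>cof Du\<close> is
  \<open>det Du\<close> times the derivative of \<open>\<psi>\<close> in direction \<open>v\<close>.\<close>

lemma inner_cof_rank_one:
  fixes A :: "real^'n^'n" and l :: "real^'n \<Rightarrow> real"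
  assumes "linear l"
  shows "inner (t *\<^sub>R cof A) (matrix (\<lambda>h. l (A *v h) *\<^sub>R v)) = t * (det A * l v)"
proof -
  have lA: "l (A *v axis j 1) = (\<Sum>m\<in>UNIV. A $ m $ j * l (axis m 1))" for j
    using linear_sum_axis[OF assms, of "A *v axis j 1"]
    by (simp add: matrix_vector_mult_basis column_def)
  have row: "(\<Sum>j\<in>UNIV. cof A $ k $ j * A $ m $ j) = (if k = m then det A else 0)" for k m
  proof -
    have "(\<Sum>j\<in>UNIV. cof A $ k $ j * A $ m $ j) = (cof A ** transpose A) $ k $ m"
      by (simp add: matrix_matrix_mult_def transpose_def)
    also have "\<dots> = (if k = m then det A else 0)"
      by (simp add: cof_mult_transpose mat_def)
    finally show ?thesis .
  qed
  have swap: "(\<Sum>j\<in>UNIV. cof A $ k $ j * ((\<Sum>m\<in>UNIV. A $ m $ j * l (axis m 1)) * v $ k))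
      = (\<Sum>m\<in>UNIV. (\<Sum>j\<in>UNIV. cof A $ k $ j * A $ m $ j) * (l (axis m 1) * v $ k))" for k
    by (simp add: sum_distrib_left sum_distrib_right mult.assoc) (rule sum.swap)
  have "inner (t *\<^sub>R cof A) (matrix (\<lambda>h. l (A *v h) *\<^sub>R v))
      = t * (\<Sum>k\<in>UNIV. \<Sum>j\<in>UNIV. cof A $ k $ j * ((\<Sum>m\<in>UNIV. A $ m $ j * l (axis m 1)) * v $ k))"
    by (simp add: inner_vec_def matrix_def lA mult.assoc flip: sum_distrib_left)
  also have "\<dots> = t * (\<Sum>k\<in>UNIV. \<Sum>m\<in>UNIV. (\<Sum>j\<in>UNIV. cof A $ k $ j * A $ m $ j) * (l (axis m 1) * v $ k))"
    by (simp only: swap)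
  also have "\<dots> = t * (\<Sum>k\<in>UNIV. det A * (v $ k * l (axis k 1)))"
    unfolding row by (simp add: if_distrib if_distribR mult_ac cong: if_cong)
  also have "\<dots> = t * (det A * l v)"
    using linear_sum_axis[OF assms, of v] by (simp add: sum_distrib_left)
  finally show ?thesis .
qed

lemma linear_bump_deriv: "linear (bump_deriv y r x)"
  by (auto intro!: linearI simp: bump_deriv_def inner_simps algebra_simps)

text \<open>The weak equation tested with \<open>\<zeta> x = bump y r (u x) v\<close>, cut off outside the box. By injectivity of \<open>u\<close>, the points of the
  closed box that \<open>u\<close> sends into the closed ball form a compact subset \<open>S\<close> of the open box, so the cut
  keeps \<open>\<zeta>\<close> continuously differentiable.\<close>

lemma integral_flux_bump_eq_0:
  fixes u :: "real^'n \<Rightarrow> real^'n"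
  assumes "open \<Omega>" and u: "C1_on u \<Omega>" and w: "weak_solution h u \<Omega>" and h: "continuous_on UNIV h"
    and c: "cball c \<rho> \<subseteq> \<Omega>" "\<rho> > 0" and ab: "cbox a b \<subseteq> ball c \<rho>"
    and inj: "inj_on u (cbox a b)" and "r > 0" and y: "cball y r \<subseteq> u ` box a b"
  shows "integral (cbox a b) (\<lambda>x. h (det (jacobian u (at x))) * (det (jacobian u (at x)) * bump_deriv y r (u x) v)) = 0"
proof -
  from w obtain G where G: "L1loc_on G \<Omega>" "weak_jacobian_on u G \<Omega>"
    and eqn: "\<And>\<zeta> :: real^'n \<Rightarrow> real^'n. C1c_on \<zeta> \<Omega> \<Longrightarrow>
           (LINT x:\<Omega>|lebesgue. inner (h (det (G x)) *\<^sub>R cof (G x)) (jacobian \<zeta> (at x))) = 0"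
    unfolding weak_solution_def by blast
  let ?J = "\<lambda>x. det (jacobian u (at x))"
  let ?Q = "\<lambda>x. h (?J x) * (?J x * bump_deriv y r (u x) v)"
  let ?N = "{x \<in> ball c \<rho>. G x \<noteq> jacobian u (at x)}"
  have N: "negligible ?N"
    by (rule weak_jacobian_eq_jacobian[OF assms(1) u G c])
  have ab\<Omega>: "cbox a b \<subseteq> \<Omega>" "box a b \<subseteq> \<Omega>" using ab c(1) box_subset_cbox[of a b] ball_subset_cball[of c \<rho>] by blast+
  have contu: "continuous_on (cbox a b) u"
    using C1_on_imp_continuous_on[OF u] ab\<Omega>(1) by (rule continuous_on_subset)
  define S where "S = cbox a b \<inter> u -` cball y r"
  have clS: "closed S" unfolding S_def
    by (rule continuous_closed_preimage[OF contu]) auto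
  then have S: "compact S" using compact_Int_closed[OF compact_cbox clS, of a b] by (simp add: S_def Int_absorb1)
  have Sbox: "S \<subseteq> box a b"
  proof
    fix x assume x: "x \<in> S"
    then obtain x' where "x' \<in> box a b" "u x = u x'" using y by (auto simp: S_def)
    then show "x \<in> box a b" using inj x box_subset_cbox[of a b] by (metis S_def IntE inj_onD subsetD)
  qed
  define \<zeta> where "\<zeta> x = (if x \<in> box a b then bump y r (u x) *\<^sub>R v else 0)" for x
  have der: "((\<lambda>x. bump y r (u x) *\<^sub>R v) has_derivative
      (\<lambda>k. bump_deriv y r (u x) (frechet_derivative u (at x) k) *\<^sub>R v)) (at x)" if "x \<in> \<Omega>" for x
    by (intro has_derivative_scaleR_left has_derivative_compose[OF C1_on_imp_has_derivative[OF u that] bump_has_derivative])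
  have "C1_on (\<lambda>x. bump y r (u x) *\<^sub>R v) (box a b)"
    by (rule C1_onI[OF der])
       (use ab\<Omega>(2) in \<open>auto intro!: continuous_intros intro: continuous_on_subset[OF _ ab\<Omega>(2)]
          C1_on_imp_continuous_on[OF u] C1_on_continuous_on_derivative[OF u]\<close>)
  then have C1: "C1_on \<zeta> UNIV" unfolding \<zeta>_def
  proof (rule C1_on_extend_zero[OF open_box clS Sbox])
    fix x assume "x \<in> box a b - S"
    then have "u x \<notin> ball y r" using box_subset_cbox[of a b] by (auto simp: S_def)
    then show "bump y r (u x) *\<^sub>R v = 0" using bump_eq_0_iff[OF \<open>r > 0\<close>, of y "u x"] by simp
  qed
  have out: "\<zeta> x = 0" if "x \<notin> S" for x
  proof (cases "x \<in> box a b")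
    case True
    then have "u x \<notin> ball y r" using that box_subset_cbox[of a b] by (auto simp: S_def)
    then show ?thesis using bump_eq_0_iff[OF \<open>r > 0\<close>, of y "u x"] by (simp add: \<zeta>_def)
  qed (simp add: \<zeta>_def)
  have "C1c_on \<zeta> \<Omega>"
    by (rule C1c_onI[OF C1_on_subset[OF C1] S]) (use Sbox ab\<Omega> out in auto)
  note zero = eqn[OF this]
  let ?F = "\<lambda>x. inner (h (det (G x)) *\<^sub>R cof (G x)) (jacobian \<zeta> (at x))"
  have jac_out: "jacobian \<zeta> (at x) = 0" if "x \<notin> S" for x
    using frechet_derivative_eq_zero_outside[OF clS out that]
    by (simp add: jacobian_def matrix_def vec_eq_iff)
  have jac_in: "jacobian \<zeta> (at x) = matrix (\<lambda>k. bump_deriv y r (u x) (jacobian u (at x) *v k) *\<^sub>R v)"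
    if "x \<in> box a b" for x
  proof -
    have x: "x \<in> \<Omega>" using that ab\<Omega> by auto
    have "(\<zeta> has_derivative
      (\<lambda>k. bump_deriv y r (u x) (frechet_derivative u (at x) k) *\<^sub>R v)) (at x)"
      by (rule has_derivative_transform_within_open[OF der[OF x] open_box that]) (simp add: \<zeta>_def)
    from frechet_derivative_at[OF this] show ?thesis
      unfolding jacobian_def
      using has_derivative_linear[OF C1_on_imp_has_derivative[OF u x]] by (simp add: matrix_works)
  qed
  \<comment> \<open>Off \<open>S\<close> both sides vanish whatever \<open>G\<close> is; on \<open>S\<close> the weak Jacobian may be replaced outside a null set.\<close>
  have FQ: "?F x = ?Q x" if "x \<in> cbox a b - ?N" for x
  proof (cases "x \<in> S")
    case True
    then have Gx: "G x = jacobian u (at x)" and x: "x \<in> box a b" using that ab Sbox by auto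
    show ?thesis
      by (simp only: Gx jac_in[OF x] inner_cof_rank_one[OF linear_bump_deriv])
  next
    case False
    then have "u x \<notin> ball y r" using that by (auto simp: S_def)
    then have "bump_deriv y r (u x) v = 0" by (rule bump_deriv_outside[OF \<open>r > 0\<close>])
    then show ?thesis using jac_out[OF False] by simp
  qed
  have "continuous_on (cbox a b) ?Q"
    by (intro continuous_intros contu continuous_on_compose2[OF h]
        continuous_on_subset[OF C1_on_continuous_on_det_jacobian[OF u] ab\<Omega>(1)]) auto
  then have "?Q absolutely_integrable_on cbox a b" by (rule absolutely_integrable_continuous)
  then have "?F absolutely_integrable_on cbox a b"
    by (rule absolutely_integrable_spike[OF _ N FQ])
  then have "(LINT x:\<Omega>|lebesgue. ?F x) = integral (cbox a b) ?F"
    by (rule set_lebesgue_integral_eq_integral_subset[OF _ ab\<Omega>(1)])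
       (use jac_out in \<open>auto simp: S_def\<close>)
  also have "\<dots> = integral (cbox a b) ?Q"
    using FQ by (intro integral_spike[OF N]) auto
  finally show ?thesis using zero by simp
qed

section \<open>Local constancy away from the zeros of the determinant\<close>

text \<open>By translation invariance the total mass of a bump does not depend on its centre.\<close>

definition bump_mass :: "'n::finite itself \<Rightarrow> real \<Rightarrow> real" where
  "bump_mass _ r = integral UNIV (bump (0 :: real^'n) r)"

lemma integral_bump_superset:
  fixes y :: "real^'n"
  assumes "r > 0" "ball y r \<subseteq> K"
  shows "integral K (bump y r) = integral UNIV (bump y r)"
  by (rule integral_spike_set; rule negligible_subset[of "{}"])
     (use bump_eq_0_iff[OF assms(1), of y] assms(2) in blast)+

lemma integral_bump:
  fixes y :: "real^'n"
  assumes "r > 0"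
  shows "integral UNIV (bump y r) = bump_mass TYPE('n) r"
proof -
  obtain c where c: "ball y r \<subseteq> cbox (- c) c"
    using bounded_subset_cbox_symmetric[OF bounded_ball] by blast
  have c0: "ball 0 r \<subseteq> cbox (- c + (- y)) (c + (- y))"
  proof
    fix x :: "real^'n" assume "x \<in> ball 0 r"
    then have "x + y \<in> ball y r" by (simp add: dist_norm)
    then have "x + y \<in> cbox (- c) c" using c by blast
    then show "x \<in> cbox (- c + (- y)) (c + (- y))" by (auto simp: mem_box inner_simps algebra_simps)
  qed
  have shift: "bump y r = bump 0 r \<circ> (+) (- y)"
    by (auto simp: bump_def)
  have "integral UNIV (bump y r) = integral (cbox (- c) c) (bump y r)"
    using integral_bump_superset[OF assms c] by simp
  also have "\<dots> = integral (cbox (- c) c) (bump 0 r \<circ> (+) (- y))"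
    by (simp only: shift)
  also have "\<dots> = integral (cbox (- c + (- y)) (c + (- y))) (bump 0 r)"
    by (rule integral_shift_cbox_plus)
  also have "\<dots> = bump_mass TYPE('n) r"
    unfolding bump_mass_def by (rule integral_bump_superset[OF assms c0])
  finally show ?thesis .
qed

lemma bump_mass_pos:
  assumes "r > 0"
  shows "bump_mass TYPE('n::finite) r > 0"
proof -
  obtain c :: "real^'n" where c: "ball 0 r \<subseteq> cbox (- c) c"
    using bounded_subset_cbox_symmetric[OF bounded_ball] by blast
  have cont: "continuous_on (cbox (- c) c) (bump (0::real^'n) r)"
    by (intro continuous_intros)
  have has: "(bump 0 r has_integral bump_mass TYPE('n) r) (cbox (- c) c)"
    using integrable_continuous[OF cont] integral_bump_superset[OF assms c]
    by (simp add: has_integral_integrable_integral bump_mass_def)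
  have "bump_mass TYPE('n) r \<noteq> 0"
  proof
    assume 0: "bump_mass TYPE('n) r = 0"
    have "ball (0::real^'n) r \<subseteq> box (- c) c"
      using interior_mono[OF c] by (simp add: interior_cbox)
    then have ne: "box (- c) c \<noteq> {}" and in_c: "0 \<in> cbox (- c) c"
      using assms c by auto
    have "bump (0::real^'n) r 0 = 0"
      by (rule has_integral_0_cbox_imp_0[OF cont bump_nonneg has[unfolded 0] ne in_c])
    then show False using bump_eq_0_iff[OF assms, of "0::real^'n" 0] assms by simp
  qed
  moreover have "bump_mass TYPE('n) r \<ge> 0"
    using has bump_nonneg by (rule has_integral_nonneg)
  ultimately show ?thesis by linarith
qed

text \<open>Weighted with the absolute Jacobian determinant, the pulled back bumps all have the same mass: they are
  approximate identities seen through the chart \<open>u\<close>.\<close>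

lemma has_integral_bump_compose:
  fixes u :: "real^'n \<Rightarrow> real^'n"
  assumes u: "C1_on u S" "cbox a b \<subseteq> S" and inj: "inj_on u (cbox a b)"
    and r: "r > 0" "cball y r \<subseteq> u ` box a b"
  shows "((\<lambda>x. \<bar>det (jacobian u (at x))\<bar> * bump y r (u x)) has_integral bump_mass TYPE('n) r) (cbox a b)"
proof -
  have contu: "continuous_on (cbox a b) u"
    using C1_on_imp_continuous_on[OF u(1)] u(2) by (rule continuous_on_subset)
  obtain c where c: "u ` cbox a b \<subseteq> cbox (- c) c"
    using bounded_subset_cbox_symmetric[OF compact_imp_bounded[OF compact_continuous_image[OF contu compact_cbox]]] .
  have sub: "ball y r \<subseteq> u ` cbox a b"
    using r(2) box_subset_cbox[of a b] ball_subset_cball[of y r] by blast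
  have "((\<lambda>x. \<bar>det (matrix (frechet_derivative u (at x)))\<bar> * bump y r (u x)) has_integral
      integral (cbox (- c) c) (bump y r)) (cbox a b)"
  proof (rule change_of_variables_cbox[OF _ inj c])
    show "(u has_derivative frechet_derivative u (at x)) (at x)" if "x \<in> cbox a b" for x
      using that u by (intro C1_on_imp_has_derivative[OF u(1)]) auto
    show "continuous_on (cbox (- c) c) (bump y r)" by (intro continuous_intros)
    show "bump y r z = 0" if "z \<notin> u ` cbox a b" for z
      using that sub bump_eq_0_iff[OF r(1), of y z] by blast
  qed
  moreover have "integral (cbox (- c) c) (bump y r) = bump_mass TYPE('n) r"
    using integral_bump_superset[OF r(1), of y "cbox (- c) c"] sub c integral_bump[OF r(1), of y] by auto
  ultimately show ?thesis by (simp add: jacobian_def)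
qed

text \<open>The inverse function theorem, fed with the inverse matrix of the Jacobian at \<open>x0\<close>. Only the continuity of the
  local inverse is kept, since later steps use it just to transport neighbourhoods.\<close>

lemma local_inverse_C1:
  fixes u :: "real^'n \<Rightarrow> real^'n"
  assumes "open \<Omega>" and u: "C1_on u \<Omega>" and "x0 \<in> \<Omega>" "det (jacobian u (at x0)) \<noteq> 0"
  shows "\<exists>U w. open U \<and> U \<subseteq> \<Omega> \<and> x0 \<in> U \<and> inj_on u U \<and> continuous_on (u ` U) w \<and> (\<forall>x\<in>U. w (u x) = x)"
proof -
  define f' where "f' x = Blinfun (frechet_derivative u (at x))" for x
  have f': "blinfun_apply (f' x) = frechet_derivative u (at x)" if "x \<in> \<Omega>" for x
    unfolding f'_def
    by (rule bounded_linear_Blinfun_apply) (rule has_derivative_bounded_linear[OF C1_on_imp_has_derivative[OF u that]])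
  have cont: "continuous_on \<Omega> f'"
  proof (rule continuous_on_blinfun_componentwise)
    fix i :: "real^'n"
    show "continuous_on \<Omega> (\<lambda>x. blinfun_apply (f' x) i)"
      by (rule continuous_on_eq[OF C1_on_continuous_on_derivative[OF u continuous_on_const]]) (simp add: f')
  qed
  let ?A = "jacobian u (at x0)"
  have "invertible ?A" using assms(4) by (simp add: invertible_det_nz)
  then obtain B where B: "B ** ?A = mat 1" by (auto simp: invertible_def)
  have lin: "frechet_derivative u (at x0) = (*v) ?A"
    using has_derivative_linear[OF C1_on_imp_has_derivative[OF u assms(3)]] by (auto simp: jacobian_def matrix_works)
  have "Blinfun ((*v) B) o\<^sub>L f' x0 = id_blinfun"
    by (rule blinfun_eqI)
       (simp add: f'[OF assms(3)] lin bounded_linear_Blinfun_apply matrix_vector_mul_bounded_linear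
          matrix_vector_mul_assoc B)
  from inverse_function_theorem[OF assms(1) _ cont assms(3) this]
  obtain U V w w' where "open U" "U \<subseteq> \<Omega>" "x0 \<in> U" "open V" "u x0 \<in> V" and hom: "homeomorphism U V u w"
    using C1_on_imp_has_derivative[OF u] f' by metis
  then show ?thesis
    by (intro exI[of _ U] exI[of _ w]) (auto simp: homeomorphism_def intro: inj_on_inverseI)
qed

text \<open>Moving the centre of the bump along the segment from \<open>y1\<close> to \<open>y2\<close> changes the weighted integral at a rate which is,
  up to the factor \<open>- \<sigma>\<close>, the flux integral that the weak equation annihilates.\<close>

lemma integral_bump_compose_constant:
  fixes u :: "real^'n \<Rightarrow> real^'n"
  assumes "open \<Omega>" and u: "C1_on u \<Omega>" and w: "weak_solution h u \<Omega>" and h: "continuous_on UNIV h"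
    and c: "cball c \<rho> \<subseteq> \<Omega>" "\<rho> > 0" and ab: "cbox a b \<subseteq> ball c \<rho>"
    and inj: "inj_on u (cbox a b)"
    and sgn: "\<And>x. x \<in> cbox a b \<Longrightarrow> \<bar>det (jacobian u (at x))\<bar> = \<sigma> * det (jacobian u (at x))"
    and r: "r > 0" and y: "\<And>y. y \<in> closed_segment y1 y2 \<Longrightarrow> cball y r \<subseteq> u ` box a b"
  shows "integral (cbox a b) (\<lambda>x. h (det (jacobian u (at x))) * (\<bar>det (jacobian u (at x))\<bar> * bump y1 r (u x)))
       = integral (cbox a b) (\<lambda>x. h (det (jacobian u (at x))) * (\<bar>det (jacobian u (at x))\<bar> * bump y2 r (u x)))"
proof -
  let ?J = "\<lambda>x. det (jacobian u (at x))"
  let ?v = "y2 - y1"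
  let ?y = "\<lambda>s. y1 + s *\<^sub>R ?v"
  let ?f = "\<lambda>s x. h (?J x) * (\<bar>?J x\<bar> * bump (?y s) r (u x))"
  let ?f' = "\<lambda>s x. h (?J x) * (\<bar>?J x\<bar> * - bump_deriv (?y s) r (u x) ?v)"
  have ab\<Omega>: "cbox a b \<subseteq> \<Omega>" using ab c(1) ball_subset_cball[of c \<rho>] by blast
  have contu: "continuous_on (cbox a b) u"
    using C1_on_imp_continuous_on[OF u] ab\<Omega> by (rule continuous_on_subset)
  have contJ: "continuous_on (cbox a b) ?J"
    using C1_on_continuous_on_det_jacobian[OF u] ab\<Omega> by (rule continuous_on_subset)
  have conth: "continuous_on (cbox a b) (\<lambda>x. h (?J x))"
    by (rule continuous_on_compose2[OF h contJ]) simp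
  have der: "((\<lambda>s. integral (cbox a b) (?f s)) has_vector_derivative 0) (at s within {0..1})"
    if s: "s \<in> {0..1}" for s
  proof -
    have "((\<lambda>s. integral (cbox a b) (?f s)) has_vector_derivative integral (cbox a b) (?f' s))
        (at s within {0..1})"
    proof (rule leibniz_rule_vector_derivative)
      fix s :: real and x
      \<comment> \<open>Moving the centre by \<open>s v\<close> amounts to moving the argument by \<open>- s v\<close>.\<close>
      have "((\<lambda>s. bump y1 r (u x - s *\<^sub>R ?v)) has_derivative
          (\<lambda>k. bump_deriv y1 r (u x - s *\<^sub>R ?v) (- (k *\<^sub>R ?v)))) (at s within {0..1})"
        by (rule has_derivative_compose[OF _ bump_has_derivative]) (auto intro!: derivative_eq_intros)
      moreover have "bump y1 r (u x - s *\<^sub>R ?v) = bump (?y s) r (u x)" for s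
        by (simp add: bump_def algebra_simps)
      moreover have "bump_deriv y1 r (u x - s *\<^sub>R ?v) (- (k *\<^sub>R ?v)) = k * - bump_deriv (?y s) r (u x) ?v" for k
        by (simp add: bump_deriv_def diff_diff_eq add.commute)
      ultimately have "((\<lambda>s. bump (?y s) r (u x)) has_real_derivative - bump_deriv (?y s) r (u x) ?v) (at s within {0..1})"
        by (auto intro: has_derivative_imp_has_field_derivative)
      from DERIV_cmult[OF this, of "h (?J x) * \<bar>?J x\<bar>"]
      show "((\<lambda>s. ?f s x) has_vector_derivative ?f' s x) (at s within {0..1})"
        by (simp add: has_real_derivative_iff_has_vector_derivative mult.assoc)
    next
      show "?f s integrable_on cbox a b" for s
        by (intro integrable_continuous continuous_intros contu contJ conth)
      have "continuous_on ({0..1} \<times> cbox a b) (\<lambda>z. u (snd z))"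
           "continuous_on ({0..1} \<times> cbox a b) (\<lambda>z. ?J (snd z))"
           "continuous_on ({0..1} \<times> cbox a b) (\<lambda>z. h (?J (snd z)))"
        by (rule continuous_on_compose2[OF contu] continuous_on_compose2[OF contJ] continuous_on_compose2[OF conth];
            auto intro!: continuous_intros)+
      then show "continuous_on ({0..1} \<times> cbox a b) (\<lambda>(s, x). ?f' s x)"
        unfolding case_prod_beta by (intro continuous_intros)
    qed (use s in auto)
    moreover have "integral (cbox a b) (?f' s) = 0"
    proof -
      have "?y s = (1 - s) *\<^sub>R y1 + s *\<^sub>R y2" by (simp add: algebra_simps)
      then have "?y s \<in> closed_segment y1 y2" using s by (auto simp: in_segment)
      from integral_flux_bump_eq_0[OF assms(1) u w h c ab inj r y[OF this], of ?v]
      have "integral (cbox a b) (\<lambda>x. - \<sigma> * (h (?J x) * (?J x * bump_deriv (?y s) r (u x) ?v))) = 0"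
        by simp
      moreover have "integral (cbox a b) (?f' s)
          = integral (cbox a b) (\<lambda>x. - \<sigma> * (h (?J x) * (?J x * bump_deriv (?y s) r (u x) ?v)))"
        by (rule Henstock_Kurzweil_Integration.integral_cong) (simp add: sgn)
      ultimately show ?thesis by simp
    qed
    ultimately show ?thesis by simp
  qed
  obtain k where k: "\<And>s. s \<in> {0..1} \<Longrightarrow> integral (cbox a b) (?f s) = k"
    using has_vector_derivative_zero_constant[OF convex_real_interval(5) der] by blast
  from k[of 0] k[of 1] show ?thesis by simp
qed

text \<open>In the chart \<open>u\<close>, averages of \<open>h (det Du)\<close> against small bumps do not depend on the centre, while by continuity they
  approximate the values at the centre. If the value at \<open>x1\<close> exceeded that at \<open>x2\<close>, bumps small enough to keep \<open>h (det Du)\<close>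
  within a third of the gap would have different averages. Exchanging the two points gives equality.\<close>

lemma locally_constant_at_nonzero_det:
  fixes u :: "real^'n \<Rightarrow> real^'n"
  assumes "open \<Omega>" and u: "C1_on u \<Omega>" and w: "weak_solution h u \<Omega>" and h: "continuous_on UNIV h"
    and x0: "x0 \<in> \<Omega>" "det (jacobian u (at x0)) \<noteq> 0"
  shows "\<exists>W. open W \<and> x0 \<in> W \<and> W \<subseteq> \<Omega> \<and>
    (\<forall>x\<in>W. h (det (jacobian u (at x))) = h (det (jacobian u (at x0))))"
proof -
  let ?J = "\<lambda>x. det (jacobian u (at x))"
  let ?g = "\<lambda>x. h (?J x)"
  obtain U v where U: "open U" "U \<subseteq> \<Omega>" "x0 \<in> U" and inj: "inj_on u U" and contv: "continuous_on (u ` U) v"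
    and vu': "\<forall>x\<in>U. v (u x) = x"
    using local_inverse_C1[OF assms(1) u x0] by blast
  have vu: "v (u x) = x" if "x \<in> U" for x using vu' that by blast
  have contJ: "continuous_on U ?J" and contu: "continuous_on U u"
    using C1_on_continuous_on_det_jacobian[OF u] C1_on_imp_continuous_on[OF u] U(2)
    by (auto intro: continuous_on_subset)
  \<comment> \<open>On this neighbourhood of \<open>x0\<close> the determinant keeps its sign, so its absolute value is a fixed multiple of it.\<close>
  define U' where "U' = U \<inter> ?J -` {t. 0 < sgn (?J x0) * t}"
  have "open U'" unfolding U'_def
    by (rule continuous_open_preimage[OF contJ U(1)]) (auto intro!: open_Collect_less continuous_intros)
  moreover have "x0 \<in> U'" using U(3) x0(2) by (auto simp: U'_def sgn_if)
  ultimately obtain \<rho> where \<rho>: "\<rho> > 0" "cball x0 \<rho> \<subseteq> U'" using open_contains_cball by blast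
  obtain a b where ab: "cbox a b \<subseteq> ball x0 \<rho>" "x0 \<in> box a b"
    using \<rho>(1) by (metis open_contains_cbox open_ball centre_in_ball)
  have abU': "cbox a b \<subseteq> U'" using ab(1) \<rho>(2) ball_subset_cball[of x0 \<rho>] by blast
  then have abU: "cbox a b \<subseteq> U" by (auto simp: U'_def)
  then have boxU: "box a b \<subseteq> U" using box_subset_cbox[of a b] by blast
  have sgnJ: "\<bar>?J x\<bar> = sgn (?J x0) * ?J x" if "x \<in> cbox a b" for x
    using abU' that by (auto simp: U'_def sgn_if split: if_splits)
  have c\<Omega>: "cball x0 \<rho> \<subseteq> \<Omega>" using \<rho>(2) U(2) by (auto simp: U'_def)
  have inj_ab: "inj_on u (cbox a b)" using inj abU by (rule inj_on_subset)
  have opn: "open (u ` box a b)"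
    by (rule invariance_of_domain[OF continuous_on_subset[OF contu boxU] open_box inj_on_subset[OF inj boxU]])
  then obtain R' where R': "R' > 0" "cball (u x0) R' \<subseteq> u ` box a b"
    using ab(2) open_contains_cball by blast
  \<comment> \<open>Centres range over the ball of radius \<open>R\<close> and bump radii are at most \<open>R\<close>, so supports stay in the ball of radius \<open>2 R\<close>.\<close>
  define R where "R = R' / 2"
  have R: "R > 0" "cball (u x0) (2 * R) \<subseteq> u ` box a b" using R' by (auto simp: R_def)
  have contg: "continuous_on (u ` box a b) (\<lambda>y. ?g (v y))"
  proof -
    have "continuous_on (u ` box a b) v" using contv boxU by (meson continuous_on_subset image_mono)
    then have "continuous_on (u ` box a b) (\<lambda>y. ?J (v y))"
      by (rule continuous_on_compose2[OF contJ]) (use boxU vu in auto)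
    then show ?thesis by (rule continuous_on_compose2[OF h]) simp
  qed
  have near: "\<exists>\<epsilon>>0. \<epsilon> \<le> R \<and> (\<forall>z\<in>cbox a b. u z \<in> ball (u x) \<epsilon> \<longrightarrow> \<bar>?g z - ?g x\<bar> < \<delta>)"
    if x: "x \<in> box a b" and "\<delta> > 0" for x \<delta>
  proof -
    have ux: "u x \<in> u ` box a b" using x by auto
    then have "continuous (at (u x)) (\<lambda>y. ?g (v y))"
      using continuous_on_eq_continuous_at[OF opn, THEN iffD1, OF contg] by blast
    then obtain d where d: "d > 0" "\<And>y. dist y (u x) < d \<Longrightarrow> dist (?g (v y)) (?g (v (u x))) < \<delta>"
      using \<open>\<delta> > 0\<close> unfolding continuous_at_eps_delta by metis
    have "\<bar>?g z - ?g x\<bar> < \<delta>" if "z \<in> cbox a b" "u z \<in> ball (u x) (min d R)" for z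
    proof -
      have "v (u z) = z" "v (u x) = x" using vu that(1) x abU boxU by blast+
      then show ?thesis using d(2)[of "u z"] that(2) by (simp add: dist_real_def dist_commute)
    qed
    then show ?thesis using d(1) R(1) by (intro exI[of _ "min d R"]) auto
  qed
  define W where "W = box a b \<inter> u -` ball (u x0) R"
  have le: "?g x1 \<le> ?g x2" if x1: "x1 \<in> W" and x2: "x2 \<in> W" for x1 x2
  proof (rule ccontr)
    assume "\<not> ?g x1 \<le> ?g x2"
    then have gt: "?g x2 < ?g x1" by simp
    define \<delta> where "\<delta> = (?g x1 - ?g x2) / 3"
    have \<delta>: "\<delta> > 0" using gt by (simp add: \<delta>_def)
    have x12: "x1 \<in> box a b" "x2 \<in> box a b" "u x1 \<in> ball (u x0) R" "u x2 \<in> ball (u x0) R"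
      using x1 x2 by (auto simp: W_def)
    obtain \<epsilon>1 where \<epsilon>1: "\<epsilon>1 > 0" "\<epsilon>1 \<le> R" "\<And>z. z \<in> cbox a b \<Longrightarrow> u z \<in> ball (u x1) \<epsilon>1 \<Longrightarrow> \<bar>?g z - ?g x1\<bar> < \<delta>"
      using near[OF x12(1) \<delta>] by blast
    obtain \<epsilon>2 where \<epsilon>2: "\<epsilon>2 > 0" "\<epsilon>2 \<le> R" "\<And>z. z \<in> cbox a b \<Longrightarrow> u z \<in> ball (u x2) \<epsilon>2 \<Longrightarrow> \<bar>?g z - ?g x2\<bar> < \<delta>"
      using near[OF x12(2) \<delta>] by blast
    define \<epsilon> where "\<epsilon> = min \<epsilon>1 \<epsilon>2"
    have \<epsilon>: "\<epsilon> > 0" "\<epsilon> \<le> R" "\<epsilon> \<le> \<epsilon>1" "\<epsilon> \<le> \<epsilon>2" using \<epsilon>1 \<epsilon>2 by (auto simp: \<epsilon>_def)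
    let ?M = "bump_mass TYPE('n) \<epsilon>"
    let ?F = "\<lambda>y x. ?g x * (\<bar>?J x\<bar> * bump y \<epsilon> (u x))"
    have sub: "cball y \<epsilon> \<subseteq> u ` box a b" if "y \<in> ball (u x0) R" for y
    proof -
      have "cball y \<epsilon> \<subseteq> cball (u x0) (2 * R)"
        using that \<epsilon>(2) by (auto simp: cball_subset_cball_iff dist_commute)
      then show ?thesis using R(2) by blast
    qed
    have mass: "((\<lambda>x. \<bar>?J x\<bar> * bump y \<epsilon> (u x)) has_integral ?M) (cbox a b)" if "y \<in> ball (u x0) R" for y
      by (rule has_integral_bump_compose[OF u _ inj_ab \<epsilon>(1) sub[OF that]]) (use abU U(2) in auto)
    have intF: "?F y integrable_on cbox a b" for y
      by (intro integrable_continuous continuous_intros continuous_on_subset[OF contu abU]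
          continuous_on_subset[OF contJ abU] continuous_on_compose2[OF h continuous_on_subset[OF contJ abU]]) simp
    have weight: "0 \<le> \<bar>?J x\<bar> * bump y \<epsilon> (u x)" for x y by (simp add: bump_nonneg)
    have "(?g x1 - \<delta>) * ?M \<le> integral (cbox a b) (?F (u x1))"
    proof (rule has_integral_le[OF has_integral_mult_right[OF mass[OF x12(3)]] integrable_integral[OF intF]])
      fix x assume x: "x \<in> cbox a b"
      show "(?g x1 - \<delta>) * (\<bar>?J x\<bar> * bump (u x1) \<epsilon> (u x)) \<le> ?F (u x1) x"
      proof (cases "u x \<in> ball (u x1) \<epsilon>")
        case True
        then have "\<bar>?g x - ?g x1\<bar> < \<delta>" using \<epsilon>1(3)[OF x] \<epsilon>(3) by auto
        then show ?thesis by (intro mult_right_mono weight) linarith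
      next
        case False
        then have "bump (u x1) \<epsilon> (u x) = 0" by (simp only: bump_eq_0_iff[OF \<epsilon>(1)] not_False_eq_True)
        then show ?thesis by simp
      qed
    qed
    moreover have "integral (cbox a b) (?F (u x2)) \<le> (?g x2 + \<delta>) * ?M"
    proof (rule has_integral_le[OF integrable_integral[OF intF] has_integral_mult_right[OF mass[OF x12(4)]]])
      fix x assume x: "x \<in> cbox a b"
      show "?F (u x2) x \<le> (?g x2 + \<delta>) * (\<bar>?J x\<bar> * bump (u x2) \<epsilon> (u x))"
      proof (cases "u x \<in> ball (u x2) \<epsilon>")
        case True
        then have "\<bar>?g x - ?g x2\<bar> < \<delta>" using \<epsilon>2(3)[OF x] \<epsilon>(4) by auto
        then show ?thesis by (intro mult_right_mono weight) linarith
      next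
        case False
        then have "bump (u x2) \<epsilon> (u x) = 0" by (simp only: bump_eq_0_iff[OF \<epsilon>(1)] not_False_eq_True)
        then show ?thesis by simp
      qed
    qed
    moreover have "integral (cbox a b) (?F (u x1)) = integral (cbox a b) (?F (u x2))"
    proof (rule integral_bump_compose_constant[OF assms(1) u w h c\<Omega> \<rho>(1) ab(1) inj_ab sgnJ \<epsilon>(1)])
      fix y assume "y \<in> closed_segment (u x1) (u x2)"
      then have "y \<in> ball (u x0) R"
        using x12(3,4) closed_segment_subset[OF _ _ convex_ball] by blast
      then show "cball y \<epsilon> \<subseteq> u ` box a b" by (rule sub)
    qed
    ultimately have "(?g x1 - \<delta>) * ?M \<le> (?g x2 + \<delta>) * ?M" by linarith
    then have "?g x1 - \<delta> \<le> ?g x2 + \<delta>"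
      using bump_mass_pos[OF \<epsilon>(1), where 'n='n] by simp
    then show False using gt by (simp add: \<delta>_def field_simps)
  qed
  show ?thesis
  proof (intro exI[of _ W] conjI ballI)
    show "open W" unfolding W_def
      by (rule continuous_open_preimage[OF continuous_on_subset[OF contu boxU]]) auto
    show x0W: "x0 \<in> W" using ab(2) R(1) by (simp add: W_def)
    show "W \<subseteq> \<Omega>" using boxU U(2) by (auto simp: W_def)
    show "?g x = ?g x0" if "x \<in> W" for x
      using le[OF that x0W] le[OF x0W that] by (rule antisym)
  qed
qed

text \<open>Where \<open>det Du\<close> vanishes, \<open>h (det Du)\<close> has the value \<open>h 0\<close>. So if some other value is taken, its level set avoids the zeros of
  \<open>det Du\<close>; it is then open by local constancy, closed by continuity, and hence all of \<open>\<Omega>\<close>.\<close>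

theorem theorem2p5:
  fixes \<Omega> :: "(real^'n) set" and h :: "real \<Rightarrow> real" and u :: "real^'n \<Rightarrow> real^'n"
  assumes "CARD('n) \<ge> 2"
    and "open \<Omega>" and "connected \<Omega>" and "\<Omega> \<noteq> {}" and "bounded \<Omega>"
    and "continuous_on UNIV h"
    and "C1_on u \<Omega>"
    and "weak_solution h u \<Omega>"
  shows "(\<lambda>x. h (det (jacobian u (at x)))) constant_on \<Omega>"
proof (cases "\<forall>x\<in>\<Omega>. h (det (jacobian u (at x))) = h 0")
  case True
  then show ?thesis by (auto simp: constant_on_def)
next
  case False
  let ?g = "\<lambda>x. h (det (jacobian u (at x)))"
  obtain x1 where x1: "x1 \<in> \<Omega>" "?g x1 \<noteq> h 0" using False by blast
  let ?T = "{x \<in> \<Omega>. ?g x = ?g x1}"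
  have "continuous_on \<Omega> ?g"
    by (rule continuous_on_compose2[OF assms(6) C1_on_continuous_on_det_jacobian[OF assms(7)]]) simp
  then have "closedin (top_of_set \<Omega>) ?T" by (rule continuous_closedin_preimage_constant)
  moreover have "open ?T"
  proof (subst open_subopen, intro ballI)
    fix x assume x: "x \<in> ?T"
    then have J: "x \<in> \<Omega>" "det (jacobian u (at x)) \<noteq> 0" using x1(2) by auto
    obtain W where "open W" "x \<in> W" "W \<subseteq> \<Omega>" "\<forall>z\<in>W. ?g z = ?g x"
      using locally_constant_at_nonzero_det[OF assms(2,7,8,6) J] by blast
    moreover have "W \<subseteq> ?T"
    proof
      fix z assume "z \<in> W"
      with \<open>W \<subseteq> \<Omega>\<close> \<open>\<forall>z\<in>W. ?g z = ?g x\<close> x show "z \<in> ?T" by fastforce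
    qed
    ultimately show "\<exists>T. open T \<and> x \<in> T \<and> T \<subseteq> ?T" by (intro exI[of _ W] conjI)
  qed
  then have "openin (top_of_set \<Omega>) ?T" by (intro open_subset) auto
  ultimately have "?T = \<Omega>" using assms(3) x1(1) unfolding connected_clopen by blast
  then show ?thesis by (auto simp: constant_on_def)
qed

end
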